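(* Let $0<\alpha<1$ and $p,q>0$. For positive semidefinite $n\times n$ complex matrices $A,B$ (any $n\in\mathbb{N}$) put $\mathcal{A}_{\alpha,p}(A,B):=((1-\alpha)A^p+\alpha B^p)^{1/p}$. Then the following conditions are equivalent: (i) $\mathcal{A}_{\alpha,p}(A,B)\le\mathcal{A}_{\alpha,q}(A,B)$ for all positive semidefinite $A,B\in\mathbb{M}_n$ and all $n\in\mathbb{N}$; (ii) $\mathcal{A}_{\alpha,p}(A,B)\le\mathcal{A}_{\alpha,q}(A,B)$ for all positive definite $2\times2$ matrices $A,B$; (iii) $p=q$, or $1\le p<q$, or $1/2\le p<1\le q$.
   Context: $\mathbb{M}_n$ denotes the $n\times n$ complex matrices. $X\le Y$ denotes the Loewner order ($Y-X$ positive semidefinite). *)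

theory Defs
  imports "Jordan_Normal_Form.Matrix"
begin

definition cadj :: "complex mat \<Rightarrow> complex mat" where
  "cadj A = mat (dim_col A) (dim_row A) (\<lambda>(i,j). cnj (A $$ (j,i)))"

definition qform :: "complex mat \<Rightarrow> complex vec \<Rightarrow> complex" where
  "qform A v = (\<Sum>i<dim_vec v. \<Sum>j<dim_vec v. cnj (v $ i) * A $$ (i,j) * v $ j)"

definition hermitian :: "nat \<Rightarrow> complex mat \<Rightarrow> bool" where
  "hermitian n A \<longleftrightarrow> A \<in> carrier_mat n n \<and> cadj A = A"

definition psd :: "nat \<Rightarrow> complex mat \<Rightarrow> bool" where
  "psd n A \<longleftrightarrow> hermitian n A \<and> (\<forall>v. dim_vec v = n \<longrightarrow> Re (qform A v) \<ge> 0)"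

definition pd :: "nat \<Rightarrow> complex mat \<Rightarrow> bool" where
  "pd n A \<longleftrightarrow> hermitian n A \<and> (\<forall>v. dim_vec v = n \<and> v \<noteq> 0\<^sub>v n \<longrightarrow> Re (qform A v) > 0)"

definition loewner_le :: "nat \<Rightarrow> complex mat \<Rightarrow> complex mat \<Rightarrow> bool" where
  "loewner_le n X Y \<longleftrightarrow> X \<in> carrier_mat n n \<and> Y \<in> carrier_mat n n \<and> psd n (Y - X)"

definition unitary :: "nat \<Rightarrow> complex mat \<Rightarrow> bool" where
  "unitary n U \<longleftrightarrow> U \<in> carrier_mat n n \<and> cadj U * U = 1\<^sub>m n"

text \<open>Real power of a PSD matrix via the spectral decomposition
  A = U diag(\<lambda>) U*, A^p = U diag(\<lambda>^p) U* (with 0^p = 0 for p > 0).\<close>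
definition mpow :: "complex mat \<Rightarrow> real \<Rightarrow> complex mat" where
  "mpow A p = (SOME X. \<exists>U l. unitary (dim_row A) U \<and> (\<forall>i<dim_row A. l i \<ge> 0) \<and>
      A = U * mat_diag (dim_row A) (\<lambda>i. complex_of_real (l i)) * cadj U \<and>
      X = U * mat_diag (dim_row A) (\<lambda>i. complex_of_real (l i powr p)) * cadj U)"

definition powmean :: "real \<Rightarrow> real \<Rightarrow> complex mat \<Rightarrow> complex mat \<Rightarrow> complex mat" where
  "powmean \<alpha> p A B = mpow (complex_of_real (1 - \<alpha>) \<cdot>\<^sub>m mpow A p + complex_of_real \<alpha> \<cdot>\<^sub>m mpow B p) (1 / p)"

end

theory Submission
  imports
    "HOL-Analysis.Equivalence_Lebesgue_Henstock_Integration"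
    "HOL-Real_Asymp.Real_Asymp"
    "Jordan_Normal_Form.Schur_Decomposition"
    "Jordan_Normal_Form.Spectral_Radius"
    Defs
begin

unbundle no vec_syntax

text \<open>Sufficiency rests on the variational formula
  \<open>\<langle>v, (A + \<mu>)\<^sup>-\<^sup>1 v\<rangle> = max\<^sub>u (2 Re \<langle>u, v\<rangle> - \<langle>u, A u\<rangle> - \<mu> \<langle>u, u\<rangle>)\<close>,
  which makes the resolvent form antitone and convex in \<open>A\<close>. Since \<open>t\<^sup>s\<close> is a positive mixture over
  \<open>\<mu>\<close> of the functions \<open>t / (t + \<mu>)\<close> for \<open>0 < s < 1\<close> and of \<open>t\<^sup>2 / (t + \<mu>)\<close> for \<open>1 < s < 2\<close>, powers
  with exponent in \<open>(0, 1]\<close> are operator monotone and operator concave, and those with exponent in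
  \<open>[1, 2]\<close> are operator convex. For \<open>1 \<le> p < q\<close> one applies the power \<open>p / q\<close> and then the power
  \<open>1 / p\<close>; for \<open>1/2 \<le> p < 1 \<le> q\<close> the arithmetic mean lies between the two power means.

  For necessity, choose \<open>A\<close> and \<open>B\<close> of size two so that the off-diagonal entries of \<open>A\<^sup>q\<close> and
  \<open>B\<^sup>q\<close> cancel in \<open>Y = (1 - \<alpha>) A\<^sup>q + \<alpha> B\<^sup>q\<close>. The inequality for the lower diagonal entries then
  forces \<open>\<lambda>\<^bsup>1/p - 2\<^esup> x\<^sup>2 \<le> y\<^bsup>1/q\<^esup>\<close>, where \<open>x\<close> is the off-diagonal entry and \<open>\<lambda>\<close> the largest eigenvalue
  of \<open>(1 - \<alpha>) A\<^sup>p + \<alpha> B\<^sup>p\<close>, and \<open>y\<close> is the lower diagonal entry of \<open>Y\<close>. Two families in which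
  \<open>y \<rightarrow> 0\<close> while \<open>\<lambda>\<close> stays away from \<open>0\<close> violate this when \<open>q < 1\<close> and when \<open>p < 1/2\<close>.\<close>

section \<open>Spectral decomposition of Hermitian matrices\<close>

text \<open>Only the first \<open>n\<close> values of \<open>f\<close> matter. They are real, so
  every such matrix is Hermitian, and they carry no order.\<close>

definition udiag :: "nat \<Rightarrow> complex mat \<Rightarrow> (nat \<Rightarrow> real) \<Rightarrow> complex mat" where
  "udiag n U f = U * mat_diag n (\<lambda>i. complex_of_real (f i)) * cadj U"

text \<open>Conjugate-linear in the first argument, matching \<open>qform\<close>, whereas
  \<open>\<bullet>c\<close> conjugates the second.\<close>

definition cinner :: "complex vec \<Rightarrow> complex vec \<Rightarrow> complex" where
  "cinner u v = (\<Sum>i<dim_vec v. cnj (u $ i) * v $ i)"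

text \<open>The \<open>k\<close>-th entry of \<open>cadj U\<close> applied to \<open>v\<close>: for
  unitary \<open>U\<close>, the coordinate of \<open>v\<close> along the \<open>k\<close>-th column
  of \<open>U\<close>.\<close>

definition ucoeff :: "complex mat \<Rightarrow> complex vec \<Rightarrow> nat \<Rightarrow> complex" where
  "ucoeff U v k = (\<Sum>i<dim_vec v. cnj (U $$ (i,k)) * v $ i)"

lemma cadj_carrier [simp]: "A \<in> carrier_mat n m \<Longrightarrow> cadj A \<in> carrier_mat m n"
  unfolding cadj_def by auto

lemma cadj_index [simp]: "i < dim_col A \<Longrightarrow> j < dim_row A \<Longrightarrow> cadj A $$ (i,j) = cnj (A $$ (j,i))"
  unfolding cadj_def by auto

lemma cadj_dim [simp]: "dim_row (cadj A) = dim_col A" "dim_col (cadj A) = dim_row A"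
  unfolding cadj_def by auto

lemma cadj_cadj [simp]: "cadj (cadj A) = A"
  by (rule eq_matI) auto

lemma cadj_mult: "A \<in> carrier_mat n m \<Longrightarrow> B \<in> carrier_mat m k \<Longrightarrow> cadj (A * B) = cadj B * cadj A"
  by (rule eq_matI) (auto simp: scalar_prod_def mult.commute)

lemma unitaryD:
  assumes "unitary n U"
  shows "U \<in> carrier_mat n n" "cadj U * U = 1\<^sub>m n" "U * cadj U = 1\<^sub>m n"
  using assms mat_mult_left_right_inverse[of "cadj U" n U] unfolding unitary_def by auto

lemmas sq_assoc = assoc_mult_mat[of _ n n _ n _ n for n]

lemmas sq_mult = mult_carrier_mat[of _ n n _ n for n]

lemma unitary_mult:
  assumes "unitary n U" "unitary n V" shows "unitary n (U * V)"
proof -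
  note c = unitaryD[OF assms(1)] unitaryD[OF assms(2)]
  have "cadj (U*V) * (U*V) = cadj V * (cadj U * U) * V"
    using c(1,4) by (simp add: cadj_mult[of _ n n _ n] sq_assoc[of _ n] sq_mult[of _ n])
  then show ?thesis using c unfolding unitary_def by simp
qed

lemma udiag_carrier [simp]: "U \<in> carrier_mat n n \<Longrightarrow> udiag n U f \<in> carrier_mat n n"
  unfolding udiag_def by (auto intro!: mult_carrier_mat[of _ n n])

lemma udiag_index:
  assumes "U \<in> carrier_mat n n" "i < n" "j < n"
  shows "udiag n U f $$ (i,j) = (\<Sum>k<n. U $$ (i,k) * f k * cnj (U $$ (j,k)))"
  using assms unfolding udiag_def
  by (subst mat_diag_mult_right[of _ n]) (auto simp: scalar_prod_def atLeast0LessThan intro!: sum.cong)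

lemma qform_udiag:
  assumes "U \<in> carrier_mat n n" "dim_vec v = n"
  shows "qform (udiag n U f) v = (\<Sum>k<n. complex_of_real (f k * (cmod (ucoeff U v k))\<^sup>2))"
proof -
  have "qform (udiag n U f) v = (\<Sum>i<n. \<Sum>j<n. \<Sum>k<n. f k * (cnj (v $ i) * U $$ (i,k)) * (cnj (U $$ (j,k)) * v $ j))"
    unfolding qform_def using assms by (auto simp: udiag_index sum_distrib_left sum_distrib_right mult_ac intro!: sum.cong)
  also have "\<dots> = (\<Sum>i<n. \<Sum>k<n. \<Sum>j<n. f k * (cnj (v $ i) * U $$ (i,k)) * (cnj (U $$ (j,k)) * v $ j))"
    by (intro sum.cong refl sum.swap)
  also have "\<dots> = (\<Sum>k<n. \<Sum>i<n. \<Sum>j<n. f k * (cnj (v $ i) * U $$ (i,k)) * (cnj (U $$ (j,k)) * v $ j))"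
    by (rule sum.swap)
  also have "\<dots> = (\<Sum>k<n. f k * (cnj (ucoeff U v k) * ucoeff U v k))"
    unfolding ucoeff_def using assms
    by (auto simp: sum_distrib_left sum_distrib_right mult_ac intro!: sum.cong)
  also have "\<dots> = (\<Sum>k<n. complex_of_real (f k * (cmod (ucoeff U v k))\<^sup>2))"
    by (intro sum.cong refl) (simp add: complex_norm_square[symmetric] mult_ac flip: of_real_power)
  finally show ?thesis .
qed

lemma hermitian_udiag: "U \<in> carrier_mat n n \<Longrightarrow> hermitian n (udiag n U f)"
  unfolding hermitian_def
  using udiag_carrier[of U n f] carrier_matD[OF udiag_carrier[of U n f]]
  by (auto intro!: eq_matI sum.cong simp: udiag_index mult_ac)

lemma psd_udiag: "U \<in> carrier_mat n n \<Longrightarrow> (\<And>i. i < n \<Longrightarrow> f i \<ge> 0) \<Longrightarrow> psd n (udiag n U f)"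
  unfolding psd_def by (auto simp: hermitian_udiag qform_udiag intro!: sum_nonneg)

text \<open>The matrix \<open>V\<^sup>* U\<close> intertwines the two diagonal matrices, hence also their images under any function.\<close>

lemma udiag_unique:
  assumes U: "unitary n U" and V: "unitary n V" and eq: "udiag n U f = udiag n V g"
  shows "udiag n U (\<lambda>i. h (f i)) = udiag n V (\<lambda>i. h (g i))"
proof -
  note c = unitaryD[OF U] unitaryD[OF V]
  let ?D = "\<lambda>f. mat_diag n (\<lambda>i. complex_of_real (f i))"
  let ?W = "cadj V * U"
  have W: "?W \<in> carrier_mat n n" using c by auto
  have 1: "?W * ?D f = cadj V * udiag n U f * U" for f
  proof -
    have "cadj V * udiag n U f * U = cadj V * U * ?D f * (cadj U * U)"
      using c(1,4) unfolding udiag_def by (simp add: sq_assoc[of _ n] sq_mult[of _ n])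
    then show ?thesis using c W by (simp add: sq_mult[of _ n] right_mult_one_mat[of _ n n] left_mult_one_mat[of _ n n])
  qed
  have 2: "?D g * ?W = cadj V * udiag n V g * U" for g
  proof -
    have "cadj V * udiag n V g * U = (cadj V * V) * ?D g * (cadj V * U)"
      using c(1,4) unfolding udiag_def by (simp add: sq_assoc[of _ n] sq_mult[of _ n])
    then show ?thesis using c W by (simp add: sq_mult[of _ n] right_mult_one_mat[of _ n n] left_mult_one_mat[of _ n n])
  qed
  have 3: "?W * ?D f = ?D g * ?W" using 1 2 eq by simp
  have "?W * ?D (\<lambda>i. h (f i)) = ?D (\<lambda>i. h (g i)) * ?W"
  proof (rule eq_matI)
    fix i j assume "i < dim_row (?D (\<lambda>i. h (g i)) * ?W)" "j < dim_col (?D (\<lambda>i. h (g i)) * ?W)"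
    then have ij: "i < n" "j < n" using W c by (auto simp: mat_diag_def)
    have "(?W * ?D f) $$ (i,j) = (?D g * ?W) $$ (i,j)" using 3 by simp
    then have "?W $$ (i,j) * f j = g i * ?W $$ (i,j)"
      by (simp only: mat_diag_mult_right[OF W] mat_diag_mult_left[OF W]) (use ij in auto)
    \<comment> \<open>Entry by entry, \<open>?W\<close> is supported where \<open>f j = g i\<close>,
      and there \<open>h\<close> takes equal values.\<close>
    then have "?W $$ (i,j) = 0 \<or> f j = g i"
      by (metis mult.commute mult_cancel_left of_real_eq_iff)
    then have "?W $$ (i,j) * h (f j) = h (g i) * ?W $$ (i,j)" by auto
    then show "(?W * ?D (\<lambda>i. h (f i))) $$ (i,j) = (?D (\<lambda>i. h (g i)) * ?W) $$ (i,j)"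
      by (simp only: mat_diag_mult_right[OF W] mat_diag_mult_left[OF W]) (use ij in auto)
  qed (use W c in \<open>auto simp: mat_diag_def\<close>)
  then have 4: "cadj V * udiag n U (\<lambda>i. h (f i)) * U = cadj V * udiag n V (\<lambda>i. h (g i)) * U" using 1 2 by simp
  have 5: "V * (cadj V * udiag n U f * U) * cadj U = udiag n U f"  "V * (cadj V * udiag n V f * U) * cadj U = udiag n V f" for f
  proof -
    have *: "V * (cadj V * S * U) * cadj U = S" if S: "S \<in> carrier_mat n n" for S
    proof -
      have "V * (cadj V * S * U) * cadj U = (V * cadj V) * S * (U * cadj U)"
        using c(1,4) S by (simp add: sq_assoc[of _ n] sq_mult[of _ n])
      then show ?thesis using c S by simp
    qed
    show "V * (cadj V * udiag n U f * U) * cadj U = udiag n U f"  "V * (cadj V * udiag n V f * U) * cadj U = udiag n V f"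
      by (rule *, simp add: c)+
  qed
  show ?thesis using 4 5 by metis
qed

text \<open>All spectral decompositions of one matrix give the same power, so the
  \<open>SOME\<close> in \<open>mpow\<close> chooses from a singleton. Nonnegativity makes
  \<open>l\<close> an admissible witness.\<close>

lemma mpow_udiag:
  assumes U: "unitary n U" and l: "\<And>i. i < n \<Longrightarrow> l i \<ge> 0"
  shows "mpow (udiag n U l) p = udiag n U (\<lambda>i. l i powr p)"
proof -
  have d: "dim_row (udiag n U l) = n" using udiag_carrier unitaryD[OF U] by blast
  show ?thesis unfolding mpow_def d
    unfolding udiag_def[symmetric]
  proof (rule some_equality)
    show "\<exists>U' l'. unitary n U' \<and> (\<forall>i<n. l' i \<ge> 0) \<and> udiag n U l = udiag n U' l' \<and>
      udiag n U (\<lambda>i. l i powr p) = udiag n U' (\<lambda>i. l' i powr p)" using U l by blast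
  next
    fix X assume "\<exists>U' l'. unitary n U' \<and> (\<forall>i<n. l' i \<ge> 0) \<and> udiag n U l = udiag n U' l' \<and> X = udiag n U' (\<lambda>i. l' i powr p)"
    then show "X = udiag n U (\<lambda>i. l i powr p)" using udiag_unique[OF _ U, of _ _ l "\<lambda>x. x powr p"] by metis
  qed
qed

text \<open>Completes \<open>v\<close> to a basis, orthogonalises by Gram-Schmidt starting with
  \<open>v\<close>, and normalises. It supplies the change of basis that splits off an
  eigenvector.\<close>

lemma unitary_extend:
  assumes v: "v \<in> carrier_vec n" and v0: "v \<noteq> 0\<^sub>v n" and n: "n \<noteq> 0"
  shows "\<exists>U c. unitary n U \<and> col U 0 = c \<cdot>\<^sub>v v"
proof -
  interpret cof_vec_space n "TYPE(complex)" .
  define b where "b = basis_completion v"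
  define ws where "ws = gram_schmidt n b"
  from basis_completion[OF v v0, folded b_def]
  have dist_b: "distinct b" and indep: "\<not> lin_dep (set b)" and b: "set b \<subseteq> carrier_vec n"
    and hdb: "hd b = v" and len_b: "length b = n" by auto
  from hdb len_b n obtain vs where bv: "b = v # vs" by (cases b, auto)
  from gram_schmidt_result[OF b dist_b indep refl, folded ws_def]
  have ws: "set ws \<subseteq> carrier_vec n" "corthogonal ws" "length ws = n"
    by (auto simp: len_b)
  from gram_schmidt_hd[OF v, of vs, folded bv] have hdws: "hd ws = v" unfolding ws_def .
  have ws0: "ws ! 0 = v" using hdws ws(3) n by (metis hd_conv_nth length_0_conv)
  have wsc: "ws ! j \<in> carrier_vec n" if "j < n" for j using ws that by auto
  \<comment> \<open>Gram-Schmidt yields orthogonal vectors without normalising them;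
    \<open>N j\<close> is the squared norm to divide out.\<close>
  define N where "N j = (\<Sum>i<n. (cmod (ws ! j $ i))\<^sup>2)" for j
  define U where "U = mat n n (\<lambda>(i,j). ws ! j $ i / complex_of_real (sqrt (N j)))"
  have ip: "ws ! k \<bullet>c ws ! j = (\<Sum>i<n. cnj (ws ! j $ i) * (ws ! k $ i))" if "j < n" "k < n" for j k
    using wsc[OF that(1)] wsc[OF that(2)] by (auto simp: scalar_prod_def atLeast0LessThan mult.commute intro!: sum.cong)
  have ipN: "ws ! j \<bullet>c ws ! j = complex_of_real (N j)" if "j < n" for j
    using that by (simp add: ip N_def complex_norm_square mult.commute del: of_real_power)
  have Npos: "N j > 0" if "j < n" for j
  proof -
    have "ws ! j \<bullet>c ws ! j \<noteq> 0" using corthogonalD[OF ws(2), of j j] that ws(3) by auto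
    then have "N j \<noteq> 0" using ipN[OF that] by auto
    moreover have "N j \<ge> 0" unfolding N_def by (auto intro: sum_nonneg)
    ultimately show ?thesis by simp
  qed
  have "cadj U * U = 1\<^sub>m n"
  proof (rule eq_matI)
    fix j k assume "j < dim_row (1\<^sub>m n)" "k < dim_col (1\<^sub>m n)"
    then have jk: "j < n" "k < n" by auto
    have "(cadj U * U) $$ (j,k) = (\<Sum>i<n. cnj (ws ! j $ i) * (ws ! k $ i) / (complex_of_real (sqrt (N j)) * complex_of_real (sqrt (N k))))"
      using jk unfolding U_def by (auto simp: scalar_prod_def atLeast0LessThan intro!: sum.cong)
    also have "\<dots> = (ws ! k \<bullet>c ws ! j) / (complex_of_real (sqrt (N j)) * complex_of_real (sqrt (N k)))"
      by (simp add: ip[OF jk] sum_divide_distrib)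
    also have "\<dots> = 1\<^sub>m n $$ (j,k)"
    proof (cases "j = k")
      case True
      have "complex_of_real (sqrt (N k)) * complex_of_real (sqrt (N k)) = complex_of_real (N k)"
        using Npos[OF jk(2)] by (simp flip: of_real_mult)
      then show ?thesis using True jk ipN[OF jk(2)] Npos[OF jk(2)] by simp
    next
      case False
      then show ?thesis using corthogonalD[OF ws(2), of k j] ws(3) jk by simp
    qed
    finally show "(cadj U * U) $$ (j,k) = 1\<^sub>m n $$ (j,k)" .
  qed (auto simp: U_def)
  moreover have "U \<in> carrier_mat n n" unfolding U_def by auto
  moreover have "col U 0 = (1 / complex_of_real (sqrt (N 0))) \<cdot>\<^sub>v v"
    using n v unfolding U_def by (intro eq_vecI) (auto simp: ws0)
  ultimately show ?thesis unfolding unitary_def by blast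
qed

text \<open>Induction on the dimension by deflation: in an orthonormal basis beginning with an
  eigenvector, the matrix splits into a one-by-one block and a Hermitian block of size
  \<open>n\<close>, to which the induction hypothesis applies.\<close>

lemma hermitian_spectral:
  assumes "hermitian n A"
  shows "\<exists>U f. unitary n U \<and> A = udiag n U f"
  using assms
proof (induction n arbitrary: A)
  case 0
  have "unitary 0 (1\<^sub>m 0)" unfolding unitary_def by auto
  moreover have "A = udiag 0 (1\<^sub>m 0) (\<lambda>_. 0)"
    using 0 carrier_matD[OF udiag_carrier[of "1\<^sub>m 0" 0 "\<lambda>_. 0"]] unfolding hermitian_def by (intro eq_matI) auto
  ultimately show ?case by blast
next
  case (Suc n)
  let ?n = "Suc n"
  have A: "A \<in> carrier_mat ?n ?n" and Ah: "cadj A = A" using Suc.prems unfolding hermitian_def by auto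
  obtain e v where ev: "eigenvector A v e"
    using spectrum_non_empty[OF A] unfolding spectrum_def eigenvalue_def by auto
  then have v: "v \<in> carrier_vec ?n" "v \<noteq> 0\<^sub>v ?n" "A *\<^sub>v v = e \<cdot>\<^sub>v v"
    using A unfolding eigenvector_def by auto
  obtain U c where U: "unitary ?n U" and U0: "col U 0 = c \<cdot>\<^sub>v v" using unitary_extend[OF v(1,2)] by auto
  note c = unitaryD[OF U]
  define A' where "A' = cadj U * A * U"
  have A'c: "A' \<in> carrier_mat ?n ?n" unfolding A'_def using c A by (auto intro!: sq_mult)
  have A'h: "cadj A' = A'" unfolding A'_def
    using c(1) A by (simp add: cadj_mult[of _ ?n ?n _ ?n] sq_assoc[of _ ?n] sq_mult[of _ ?n] Ah)
  have A'cnj: "cnj (A' $$ (j,i)) = A' $$ (i,j)" if "i < ?n" "j < ?n" for i j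
    using that A'h A'c by (metis cadj_index carrier_matD)
  \<comment> \<open>The zeroth column of \<open>A * U\<close> is \<open>e\<close> times that of
    \<open>U\<close>, and \<open>cadj U\<close> sends the latter to the first standard basis
    vector.\<close>
  have col0: "A' $$ (i,0) = (if i = 0 then e else 0)" if i: "i < ?n" for i
  proof -
    have "col (A * U) 0 = A *\<^sub>v col U 0" using A c(1) by auto
    also have "\<dots> = e \<cdot>\<^sub>v col U 0" using A v by (simp add: U0 mult_mat_vec[of _ ?n ?n] smult_smult_assoc mult.commute)
    finally have 1: "col (A * U) 0 = e \<cdot>\<^sub>v col U 0" .
    have "A' = cadj U * (A * U)" unfolding A'_def using A c(1) by (simp add: sq_assoc[of _ ?n])
    then have "A' $$ (i,0) = row (cadj U) i \<bullet> col (A * U) 0" using i A c(1) by simp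
    also have "\<dots> = e * (row (cadj U) i \<bullet> col U 0)"
      unfolding 1 using c(1) i by (intro scalar_prod_smult_distrib[of _ ?n]) (auto intro!: carrier_vecI)
    also have "row (cadj U) i \<bullet> col U 0 = (cadj U * U) $$ (i,0)" using i c(1) by simp
    finally show ?thesis using i c by simp
  qed
  have row0: "A' $$ (0,i) = (if i = 0 then e else 0)" if i: "i < ?n" for i
    using A'cnj[of 0 i] A'cnj[of 0 0] col0[of i] col0[of 0] i by auto
  \<comment> \<open>The corner is its own conjugate, so the eigenvalue is real, as
    \<open>udiag\<close> demands.\<close>
  have e: "complex_of_real (Re e) = e" using A'cnj[of 0 0] col0[of 0] by (simp add: complex_eq_iff)
  define B where "B = mat n n (\<lambda>(i,j). A' $$ (Suc i, Suc j))"
  have "hermitian n B" unfolding hermitian_def B_def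
    by (auto intro!: eq_matI simp: A'cnj)
  from Suc.IH[OF this] obtain V g where V: "unitary n V" and B: "B = udiag n V g" by auto
  note d = unitaryD[OF V]
  \<comment> \<open>\<open>V'\<close> is the block sum of 1 and \<open>V\<close>; \<open>f\<close>
    prepends the split-off eigenvalue to \<open>g\<close>.\<close>
  define V' where "V' = mat ?n ?n (\<lambda>(i,j). if i = 0 \<and> j = 0 then 1 else if i = 0 \<or> j = 0 then 0 else V $$ (i - 1, j - 1))"
  define f where "f = case_nat (Re e) g"
  have V'c: "V' \<in> carrier_mat ?n ?n" unfolding V'_def by auto
  have "cadj V' * V' = 1\<^sub>m ?n"
  proof (rule eq_matI)
    fix i j assume "i < dim_row (1\<^sub>m ?n)" "j < dim_col (1\<^sub>m ?n)"
    then have ij: "i < ?n" "j < ?n" by auto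
    have "(cadj V' * V') $$ (i,j) = (\<Sum>k<?n. cnj (V' $$ (k,i)) * V' $$ (k,j))"
      using ij V'c by (auto simp: scalar_prod_def atLeast0LessThan intro!: sum.cong)
    also have "\<dots> = cnj (V' $$ (0,i)) * V' $$ (0,j) + (\<Sum>k<n. cnj (V' $$ (Suc k,i)) * V' $$ (Suc k,j))"
      by (rule sum.lessThan_Suc_shift)
    also have "\<dots> = 1\<^sub>m ?n $$ (i,j)"
    proof (cases i; cases j)
      fix i' j' assume s: "i = Suc i'" "j = Suc j'"
      have "(\<Sum>k<n. cnj (V $$ (k,i')) * V $$ (k,j')) = (cadj V * V) $$ (i',j')"
        using ij s d(1) by (auto simp: scalar_prod_def atLeast0LessThan intro!: sum.cong)
      then show ?thesis using ij s d unfolding V'_def by auto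
    qed (use ij in \<open>auto simp: V'_def\<close>)
    finally show "(cadj V' * V') $$ (i,j) = 1\<^sub>m ?n $$ (i,j)" .
  qed (use V'c in auto)
  then have V': "unitary ?n V'" unfolding unitary_def using V'c by auto
  have "A' = udiag ?n V' f"
  proof (rule eq_matI)
    fix i j assume "i < dim_row (udiag ?n V' f)" "j < dim_col (udiag ?n V' f)"
    then have ij: "i < ?n" "j < ?n" using carrier_matD[OF udiag_carrier[OF V'c, of f]] by auto
    have "udiag ?n V' f $$ (i,j) = V' $$ (i,0) * f 0 * cnj (V' $$ (j,0)) + (\<Sum>k<n. V' $$ (i,Suc k) * f (Suc k) * cnj (V' $$ (j,Suc k)))"
      unfolding udiag_index[OF V'c ij] by (rule sum.lessThan_Suc_shift)
    also have "\<dots> = A' $$ (i,j)"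
    proof (cases i; cases j)
      fix i' j' assume s: "i = Suc i'" "j = Suc j'"
      have "A' $$ (i,j) = B $$ (i',j')" using ij s unfolding B_def by auto
      also have "\<dots> = (\<Sum>k<n. V $$ (i',k) * g k * cnj (V $$ (j',k)))"
        unfolding B using ij s d by (simp add: udiag_index)
      finally show ?thesis using ij s unfolding V'_def f_def by auto
    qed (use ij in \<open>auto simp: V'_def f_def col0 row0 e\<close>)
    finally show "A' $$ (i,j) = udiag ?n V' f $$ (i,j)" by simp
  qed (use A'c carrier_matD[OF udiag_carrier[OF V'c, of f]] in auto)
  moreover have "A = U * A' * cadj U"
  proof -
    have "U * A' * cadj U = (U * cadj U) * A * (U * cadj U)"
      unfolding A'_def using c(1) A by (simp add: sq_assoc[of _ ?n] sq_mult[of _ ?n])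
    then show ?thesis using c A by simp
  qed
  ultimately have "A = udiag ?n (U * V') f"
    unfolding udiag_def using c(1) V'c
    by (simp add: sq_assoc[of _ ?n] sq_mult[of _ ?n] cadj_mult[of _ ?n ?n _ ?n])
  then show ?case using unitary_mult[OF U V'] by blast
qed

lemma ucoeff_col:
  assumes "unitary n U" "k < n" "j < n"
  shows "ucoeff U (col U k) j = (if j = k then 1 else 0)"
proof -
  note c = unitaryD[OF assms(1)]
  have "ucoeff U (col U k) j = (cadj U * U) $$ (j,k)"
    using assms c(1) unfolding ucoeff_def by (auto simp: scalar_prod_def atLeast0LessThan intro!: sum.cong)
  then show ?thesis using c assms by simp
qed

text \<open>The form at the \<open>k\<close>-th column of \<open>U\<close> equals
  \<open>l k\<close>, so positivity of the form gives nonnegative eigenvalues.\<close>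

lemma psd_spectral:
  assumes "psd n A"
  obtains U l where "unitary n U" "\<forall>i<n. l i \<ge> 0" "A = udiag n U l"
proof -
  obtain U l where U: "unitary n U" and A: "A = udiag n U l"
    using assms hermitian_spectral unfolding psd_def by blast
  have "l k \<ge> 0" if k: "k < n" for k
  proof -
    have "Re (qform A (col U k)) \<ge> 0" using assms unitaryD(1)[OF U] unfolding psd_def by simp
    moreover have "qform A (col U k) = (\<Sum>j<n. if j = k then l k else 0)"
      unfolding A using unitaryD(1)[OF U]
      by (subst qform_udiag) (auto simp only: carrier_matD dim_col of_real_sum ucoeff_col[OF U k] lessThan_iff intro!: sum.cong, auto)
    ultimately show ?thesis using k by simp
  qed
  then show thesis using that U A by blast
qed

section \<open>Resolvents and the integral representation of powers\<close>

text \<open>The substitution \<open>\<mu> = e\<^sup>x\<close> turns the scaling behaviour of the integral representation of \<open>t\<^sup>s\<close>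
  into translation invariance of Lebesgue measure.\<close>

lemma powr_kernel_integral:
  assumes s: "0 < s" "s < 1"
  obtains c where "c > 0" "\<And>t. t \<ge> 0 \<Longrightarrow>
    has_bochner_integral lborel (\<lambda>x::real. exp (s * x) * (t / (t + exp x))) (c * t powr s)"
proof -
  \<comment> \<open>\<open>g\<close> is the integrand for \<open>t = 1\<close>.\<close>
  define g :: "real \<Rightarrow> real" where "g x = exp (s * x) / (1 + exp x)" for x
  define m where "m = min s (1 - s)"
  \<comment> \<open>On both half-lines \<open>g x\<close> is at most
    \<open>exp (- m * \<bar>x\<bar>)\<close>; \<open>h\<close> carries the right half of this bound
    and its reflection the left half.\<close>
  have m: "m > 0" using s by (simp add: m_def)
  define h where "h x = exp (- m * x) * indicator {0..} x" for x :: real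
  have pos: "1 + exp x > 0" for x :: real by (simp add: add_pos_pos)
  have h: "integrable lborel h"
  proof (rule integrableI_nonneg)
    have "(\<integral>\<^sup>+x. ennreal (exp (- m * x)) * indicator {0..} x \<partial>lborel) = ennreal (0 - (- exp (- m * 0) / m))"
    proof (rule nn_integral_FTC_atLeast)
      show "((\<lambda>x. - exp (- m * x) / m) \<longlongrightarrow> 0) at_top" using m by real_asymp
      show "((\<lambda>x. - exp (- m * x) / m) has_real_derivative exp (- m * x)) (at x)" for x
        using m by (auto intro!: derivative_eq_intros)
    qed auto
    then show "(\<integral>\<^sup>+x. ennreal (h x) \<partial>lborel) < \<infinity>"
      by (simp add: h_def ennreal_mult ennreal_indicator)
  qed (auto simp: h_def[abs_def])
  have h': "integrable lborel (\<lambda>x. h (- x))"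
    using lborel_integrable_real_affine[OF h, of "-1" 0] by simp
  have g: "integrable lborel g"
  proof (rule Bochner_Integration.integrable_bound[OF Bochner_Integration.integrable_add[OF h h']])
    show "AE x in lborel. norm (g x) \<le> norm (h x + h (- x))"
    proof (rule AE_I2)
      fix x :: real
      have "g x \<le> h x + h (- x)"
      proof (cases "x \<ge> 0")
        case True
        have "g x \<le> exp (s * x) / exp x" unfolding g_def by (intro divide_left_mono) (auto simp: pos)
        also have "\<dots> = exp (- (1 - s) * x)" by (simp add: exp_diff[symmetric] algebra_simps)
        also have "\<dots> \<le> exp (- m * x)" using mult_right_mono[of m "1 - s" x] True by (simp add: m_def algebra_simps)
        finally show ?thesis using True by (auto simp: h_def indicator_def)
      next
        case False
        have "g x \<le> exp (s * x) / 1" unfolding g_def by (intro divide_left_mono) (auto simp: pos)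
        also have "\<dots> \<le> exp (m * x)" using mult_right_mono_neg[of m s x] False by (simp add: m_def)
        finally show ?thesis using False by (auto simp: h_def indicator_def)
      qed
      moreover have "g x \<ge> 0" using pos[of x] by (simp add: g_def)
      ultimately show "norm (g x) \<le> norm (h x + h (- x))" by simp
    qed
  qed (auto simp: g_def[abs_def])
  define c where "c = integral\<^sup>L lborel g"
  have gpos: "g x > 0" for x using pos[of x] by (simp add: g_def)
  \<comment> \<open>A positive function with integral zero would vanish almost everywhere, but the
    line is not a null set.\<close>
  have "c \<noteq> 0"
  proof
    assume "c = 0"
    then have "AE x in lborel. g x = 0"
      using integral_nonneg_eq_0_iff_AE[OF g] gpos unfolding c_def by (simp add: less_imp_le)
    then have "AE x in (lborel :: real measure). False" using gpos by (auto elim!: eventually_mono) (metis less_irrefl)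
    then show False by (simp add: AE_iff_null null_sets_def)
  qed
  moreover have "c \<ge> 0" unfolding c_def using gpos by (intro Bochner_Integration.integral_nonneg) (simp add: less_imp_le)
  ultimately have c: "c > 0" by simp
  have "has_bochner_integral lborel (\<lambda>x. exp (s * x) * (t / (t + exp x))) (c * t powr s)" if t: "t \<ge> 0" for t
  proof (cases "t = 0")
    case True then show ?thesis by (simp add: has_bochner_integral_zero)
  next
    case False
    with t have t: "t > 0" by simp
    have "has_bochner_integral lborel g c" using g unfolding c_def by (rule has_bochner_integral_integrable)
    \<comment> \<open>Translating by \<open>ln t\<close> turns the kernel at 1 into the kernel at
      \<open>t\<close>, up to the factor \<open>t powr s\<close>.\<close>
    then have "has_bochner_integral lborel (\<lambda>x. g (- ln t + 1 * x)) (c /\<^sub>R \<bar>1\<bar>)"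
      by (subst (asm) lborel_has_bochner_integral_real_affine_iff[where c=1 and t="- ln t"]) auto
    then have "has_bochner_integral lborel (\<lambda>x. t powr s * g (- ln t + 1 * x)) (t powr s * c)"
      by (intro has_bochner_integral_mult_right) simp
    moreover have "t powr s * g (- ln t + 1 * x) = exp (s * x) * (t / (t + exp x))" for x
    proof -
      have e1: "exp (s * (- ln t + 1 * x)) = exp (s * x) / t powr s"
        using t by (simp add: powr_def exp_diff[symmetric] algebra_simps)
      have e2: "exp (- ln t + 1 * x) = exp x / t"
        using t by (simp add: exp_diff)
      have e3: "1 + exp x / t = (t + exp x) / t" using t by (simp add: field_simps)
      show ?thesis unfolding g_def e1 e2 e3 using t by simp
    qed
    ultimately show ?thesis by (simp add: mult.commute)
  qed
  then show thesis using that c by blast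
qed

section \<open>Parseval's identity and the variational formula for the resolvent\<close>

lemma cinner_ucoeff:
  assumes "unitary n U" "dim_vec u = n" "dim_vec v = n"
  shows "cinner u v = (\<Sum>k<n. cnj (ucoeff U u k) * ucoeff U v k)"
proof -
  note c = unitaryD[OF assms(1)]
  have "(\<Sum>k<n. cnj (ucoeff U u k) * ucoeff U v k) =
    (\<Sum>k<n. \<Sum>i<n. \<Sum>j<n. cnj (u $ i) * v $ j * (U $$ (i,k) * cnj (U $$ (j,k))))"
    unfolding ucoeff_def assms(2,3) cnj_sum sum_product by (intro sum.cong refl) (simp add: mult_ac)
  also have "\<dots> = (\<Sum>i<n. \<Sum>k<n. \<Sum>j<n. cnj (u $ i) * v $ j * (U $$ (i,k) * cnj (U $$ (j,k))))"
    by (rule sum.swap)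
  also have "\<dots> = (\<Sum>i<n. \<Sum>j<n. \<Sum>k<n. cnj (u $ i) * v $ j * (U $$ (i,k) * cnj (U $$ (j,k))))"
    by (intro sum.cong refl sum.swap)
  \<comment> \<open>\<open>U * cadj U\<close> is the identity, which is the completeness of the
    columns that Parseval's identity needs.\<close>
  also have "\<dots> = (\<Sum>i<n. \<Sum>j<n. cnj (u $ i) * v $ j * (U * cadj U) $$ (i,j))"
    using c(1) by (intro sum.cong refl) (auto simp: scalar_prod_def atLeast0LessThan sum_distrib_left)
  also have "\<dots> = (\<Sum>i<n. \<Sum>j<n. if j = i then cnj (u $ i) * v $ i else 0)"
    unfolding c(3) by (intro sum.cong refl) auto
  also have "\<dots> = cinner u v" unfolding cinner_def by (simp add: assms)
  finally show ?thesis by simp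
qed

lemma cinner_self:
  assumes "unitary n U" "dim_vec v = n"
  shows "Re (cinner v v) = (\<Sum>k<n. (cmod (ucoeff U v k))\<^sup>2)"
  unfolding cinner_ucoeff[OF assms assms(2)] Re_sum
  by (intro sum.cong refl) (simp add: cmod_power2 flip: power2_eq_square)

text \<open>The vector is \<open>U\<close> applied to \<open>c\<close>. This allows the maximiser of
  the variational formula to be prescribed by its coordinates.\<close>

lemma ucoeff_surj:
  assumes "unitary n U"
  obtains u where "dim_vec u = n" "\<And>k. k < n \<Longrightarrow> ucoeff U u k = c k"
proof -
  note d = unitaryD[OF assms]
  define u where "u = vec n (\<lambda>i. \<Sum>k<n. U $$ (i,k) * c k)"
  have "ucoeff U u j = c j" if j: "j < n" for j
  proof -
    have "ucoeff U u j = (\<Sum>i<n. \<Sum>k<n. c k * (cnj (U $$ (i,j)) * U $$ (i,k)))"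
      unfolding ucoeff_def u_def by (simp add: sum_distrib_left mult_ac)
    also have "\<dots> = (\<Sum>k<n. \<Sum>i<n. c k * (cnj (U $$ (i,j)) * U $$ (i,k)))"
      by (rule sum.swap)
    also have "\<dots> = (\<Sum>k<n. c k * (cadj U * U) $$ (j,k))"
      using d(1) j by (intro sum.cong refl) (auto simp: scalar_prod_def atLeast0LessThan sum_distrib_left)
    also have "\<dots> = (\<Sum>k<n. if k = j then c k else 0)"
      unfolding d(2) using j by (intro sum.cong refl) auto
    finally show ?thesis using j by simp
  qed
  then show thesis using that[of u] by (simp add: u_def)
qed

lemma Re_qform_udiag:
  assumes "U \<in> carrier_mat n n" "dim_vec v = n"
  shows "Re (qform (udiag n U f) v) = (\<Sum>k<n. f k * (cmod (ucoeff U v k))\<^sup>2)"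
  by (simp add: qform_udiag[OF assms] del: of_real_mult)

text \<open>The value of \<open>\<langle>v, (A + \<mu>)\<^sup>-\<^sup>1 v\<rangle>\<close> for \<open>A = udiag n U l\<close>.\<close>

definition resolvent :: "nat \<Rightarrow> complex mat \<Rightarrow> (nat \<Rightarrow> real) \<Rightarrow> real \<Rightarrow> complex vec \<Rightarrow> real" where
  "resolvent n U l \<mu> v = (\<Sum>k<n. (cmod (ucoeff U v k))\<^sup>2 / (l k + \<mu>))"

text \<open>In the coordinates of \<open>U\<close> the problem decouples: with
  \<open>s = l k + \<mu>\<close>, each term is bounded by the arithmetic-geometric mean inequality
  for \<open>sqrt s * cmod a\<close> and \<open>cmod b / sqrt s\<close>.\<close>

lemma resolvent_upper:
  assumes U: "unitary n U" and l: "\<forall>k<n. l k \<ge> 0" and \<mu>: "\<mu> > 0"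
    and d: "dim_vec u = n" "dim_vec v = n"
  shows "2 * Re (cinner u v) - Re (qform (udiag n U l) u) - \<mu> * Re (cinner u u) \<le> resolvent n U l \<mu> v"
proof -
  have "2 * Re (cnj a * b) - s * (cmod a)\<^sup>2 \<le> (cmod b)\<^sup>2 / s" if "s > 0" for a b :: complex and s :: real
  proof -
    have "Re (cnj a * b) \<le> cmod a * cmod b" using complex_Re_le_cmod[of "cnj a * b"] by (simp add: norm_mult)
    moreover have "2 * (cmod a * cmod b) \<le> s * (cmod a)\<^sup>2 + (cmod b)\<^sup>2 / s"
      using sum_squares_bound[of "sqrt s * cmod a" "cmod b / sqrt s"] that
      by (simp add: power_mult_distrib power_divide)
    ultimately show ?thesis by linarith
  qed
  then have "(\<Sum>k<n. 2 * Re (cnj (ucoeff U u k) * ucoeff U v k) - (l k + \<mu>) * (cmod (ucoeff U u k))\<^sup>2) \<le> resolvent n U l \<mu> v"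
    unfolding resolvent_def by (intro sum_mono) (metis add_nonneg_pos l lessThan_iff \<mu>)
  also have "(\<Sum>k<n. 2 * Re (cnj (ucoeff U u k) * ucoeff U v k) - (l k + \<mu>) * (cmod (ucoeff U u k))\<^sup>2) =
     2 * Re (cinner u v) - Re (qform (udiag n U l) u) - \<mu> * Re (cinner u u)"
    unfolding Re_qform_udiag[OF unitaryD(1)[OF U] d(1)] cinner_self[OF U d(1)] cinner_ucoeff[OF U d]
    by (simp add: sum_subtractf sum.distrib ring_distribs sum_distrib_left mult.assoc del: complex_cnj_mult times_complex.sel)
  finally show ?thesis .
qed

text \<open>Equality holds when every coordinate of \<open>u\<close> is that of \<open>v\<close>
  divided by \<open>l k + \<mu>\<close>, that is, when \<open>u\<close> is the resolvent applied to
  \<open>v\<close>.\<close>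

lemma resolvent_attained:
  assumes U: "unitary n U" and l: "\<forall>k<n. l k \<ge> 0" and \<mu>: "\<mu> > 0" and d: "dim_vec v = n"
  obtains u where "dim_vec u = n"
    "2 * Re (cinner u v) - Re (qform (udiag n U l) u) - \<mu> * Re (cinner u u) = resolvent n U l \<mu> v"
proof -
  obtain u where u: "dim_vec u = n" "\<And>k. k < n \<Longrightarrow> ucoeff U u k = ucoeff U v k / complex_of_real (l k + \<mu>)"
    using ucoeff_surj[OF U, of "\<lambda>k. ucoeff U v k / complex_of_real (l k + \<mu>)"] by blast
  have "2 * Re (cnj (b / complex_of_real s) * b) - s * (cmod (b / complex_of_real s))\<^sup>2 = (cmod b)\<^sup>2 / s"
    if "s > 0" for b :: complex and s :: real
  proof -
    have "cnj (b / complex_of_real s) * b = complex_of_real ((cmod b)\<^sup>2 / s)"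
      using complex_norm_square[of b] by (simp add: mult.commute)
    then show ?thesis using that by (simp add: norm_divide power_divide power2_eq_square field_simps)
  qed
  then have "resolvent n U l \<mu> v = (\<Sum>k<n. 2 * Re (cnj (ucoeff U u k) * ucoeff U v k) - (l k + \<mu>) * (cmod (ucoeff U u k))\<^sup>2)"
    unfolding resolvent_def by (intro sum.cong refl) (metis add_nonneg_pos l lessThan_iff \<mu> u(2))
  also have "(\<Sum>k<n. 2 * Re (cnj (ucoeff U u k) * ucoeff U v k) - (l k + \<mu>) * (cmod (ucoeff U u k))\<^sup>2) =
     2 * Re (cinner u v) - Re (qform (udiag n U l) u) - \<mu> * Re (cinner u u)"
    unfolding Re_qform_udiag[OF unitaryD(1)[OF U] u(1)] cinner_self[OF U u(1)] cinner_ucoeff[OF U u(1) d]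
    by (simp add: sum_subtractf sum.distrib ring_distribs sum_distrib_left mult.assoc del: complex_cnj_mult times_complex.sel)
  finally show thesis using that[OF u(1)] by simp
qed

section \<open>Operator inequalities for resolvents and powers\<close>

lemma has_bochner_integral_mono:
  fixes f g :: "'a \<Rightarrow> real"
  assumes "has_bochner_integral M f a" "has_bochner_integral M g b" "\<And>x. f x \<le> g x"
  shows "a \<le> b"
  using assms integral_mono[of M f g] by (auto simp: has_bochner_integral_iff)

text \<open>Three positive semidefinite matrices by their spectral data, the third dominating a
  weighted mean of the first two. Leaving it free, rather than equal to the mean, treats operator
  monotonicity and concavity together.\<close>

locale spectral_triple =
  fixes n :: nat and U V W :: "complex mat" and l m k :: "nat \<Rightarrow> real" and \<alpha> :: real
  assumes U: "unitary n U" and V: "unitary n V" and W: "unitary n W"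
    and l: "\<forall>i<n. l i \<ge> 0" and m: "\<forall>i<n. m i \<ge> 0" and k: "\<forall>i<n. k i \<ge> 0"
    and \<alpha>: "0 \<le> \<alpha>" "\<alpha> \<le> 1"
    and le: "\<And>u. dim_vec u = n \<Longrightarrow>
      (1 - \<alpha>) * Re (qform (udiag n U l) u) + \<alpha> * Re (qform (udiag n V m) u) \<le> Re (qform (udiag n W k) u)"
begin

text \<open>The maximiser for the third matrix is a competitor for the other two, and the functional
  is affine in the matrix, which enters with a minus sign.\<close>

lemma resolvent_le:
  assumes "\<mu> > 0" "dim_vec v = n"
  shows "resolvent n W k \<mu> v \<le> (1 - \<alpha>) * resolvent n U l \<mu> v + \<alpha> * resolvent n V m \<mu> v"
proof -
  obtain u where u: "dim_vec u = n"
    "2 * Re (cinner u v) - Re (qform (udiag n W k) u) - \<mu> * Re (cinner u u) = resolvent n W k \<mu> v"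
    using resolvent_attained[where l=k, OF W k assms] by blast
  note 1 = mult_left_mono[OF resolvent_upper[where l=l, OF U l assms(1) u(1) assms(2)], of "1 - \<alpha>"]
  note 2 = mult_left_mono[OF resolvent_upper[where l=m, OF V m assms(1) u(1) assms(2)], of \<alpha>]
  show ?thesis using 1 2 le[OF u(1)] u(2) \<alpha> by (simp add: algebra_simps)
qed

end

text \<open>Rests on \<open>t / (t + \<mu>) = 1 - \<mu> / (t + \<mu>)\<close>. The minus sign turns
  the upper bound on the third resolvent into a lower bound on its kernel.\<close>

lemma resolvent_kernel:
  assumes U: "unitary n U" and l: "\<forall>k<n. l k \<ge> 0" and \<mu>: "\<mu> > 0" and d: "dim_vec v = n"
  shows "(\<Sum>i<n. (cmod (ucoeff U v i))\<^sup>2 * (l i / (l i + \<mu>))) = Re (cinner v v) - \<mu> * resolvent n U l \<mu> v"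
proof -
  have "a * (t / (t + \<mu>)) = a - \<mu> * (a / (t + \<mu>))" if "t \<ge> 0" for a t :: real
    using that \<mu> by (simp add: field_simps)
  then have "(\<Sum>i<n. (cmod (ucoeff U v i))\<^sup>2 * (l i / (l i + \<mu>))) = (\<Sum>i<n. (cmod (ucoeff U v i))\<^sup>2 - \<mu> * ((cmod (ucoeff U v i))\<^sup>2 / (l i + \<mu>)))"
    using l by (intro sum.cong) auto
  then show ?thesis unfolding cinner_self[OF U d] resolvent_def
    by (simp add: sum_subtractf sum_distrib_left)
qed

text \<open>Rests on \<open>t^2 / (t + \<mu>) = t - \<mu> + \<mu>^2 / (t + \<mu>)\<close>. The
  resolvent now enters with a plus sign, which yields convexity, and a linear term appears.\<close>

lemma resolvent_kernel2:
  assumes U: "unitary n U" and l: "\<forall>k<n. l k \<ge> 0" and \<mu>: "\<mu> > 0" and d: "dim_vec v = n"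
  shows "(\<Sum>i<n. (cmod (ucoeff U v i))\<^sup>2 * l i * (l i / (l i + \<mu>))) =
    Re (qform (udiag n U l) v) - \<mu> * Re (cinner v v) + \<mu>\<^sup>2 * resolvent n U l \<mu> v"
proof -
  have "a * t * (t / (t + \<mu>)) = t * a - \<mu> * a + \<mu>\<^sup>2 * (a / (t + \<mu>))" if "t \<ge> 0" for a t :: real
    using that \<mu> by (simp add: field_simps power2_eq_square)
  then have "(\<Sum>i<n. (cmod (ucoeff U v i))\<^sup>2 * l i * (l i / (l i + \<mu>))) =
     (\<Sum>i<n. l i * (cmod (ucoeff U v i))\<^sup>2 - \<mu> * (cmod (ucoeff U v i))\<^sup>2 + \<mu>\<^sup>2 * ((cmod (ucoeff U v i))\<^sup>2 / (l i + \<mu>)))"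
    using l by (intro sum.cong) auto
  then show ?thesis unfolding cinner_self[OF U d] resolvent_def Re_qform_udiag[OF unitaryD(1)[OF U] d]
    by (simp add: sum_subtractf sum.distrib sum_distrib_left)
qed

context spectral_triple begin

text \<open>Integrating the kernel inequality over \<open>\<mu> = exp x\<close> with the weight
  \<open>exp (s * x)\<close> gives the claim up to the factor \<open>c\<close>. For
  \<open>s = 1\<close>, where the integral formula breaks down, the claim is the assumption
  itself.\<close>

lemma powr_concave:
  assumes s: "0 < s" "s \<le> 1" and v: "dim_vec v = n"
  shows "(1 - \<alpha>) * Re (qform (udiag n U (\<lambda>i. l i powr s)) v) + \<alpha> * Re (qform (udiag n V (\<lambda>i. m i powr s)) v)
    \<le> Re (qform (udiag n W (\<lambda>i. k i powr s)) v)"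
proof (cases "s = 1")
  case True
  then show ?thesis using le[OF v] l m k
    by (simp add: Re_qform_udiag[OF _ v] unitaryD(1)[OF U] unitaryD(1)[OF V] unitaryD(1)[OF W])
next
  case False
  with s have "s < 1" by simp
  from powr_kernel_integral[OF s(1) this] obtain c where c: "c > 0" "\<And>t. t \<ge> 0 \<Longrightarrow>
    has_bochner_integral lborel (\<lambda>x::real. exp (s * x) * (t / (t + exp x))) (c * t powr s)" by blast
  define P where "P U l x = exp (s * x) * (\<Sum>i<n. (cmod (ucoeff U v i))\<^sup>2 * (l i / (l i + exp x)))" for U l x
  have P: "has_bochner_integral lborel (P U l) (c * Re (qform (udiag n U (\<lambda>i. l i powr s)) v))"
    if "unitary n U" "\<forall>i<n. l i \<ge> 0" for U l
  proof -
    have "has_bochner_integral lborel (\<lambda>x. \<Sum>i<n. (cmod (ucoeff U v i))\<^sup>2 * (exp (s * x) * (l i / (l i + exp x))))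
       (\<Sum>i<n. (cmod (ucoeff U v i))\<^sup>2 * (c * l i powr s))"
      using c(2) that by (intro has_bochner_integral_sum has_bochner_integral_mult_right) auto
    then show ?thesis unfolding P_def Re_qform_udiag[OF unitaryD(1)[OF that(1)] v]
      by (simp add: sum_distrib_left mult_ac)
  qed
  note I = P[of U l, OF U l] P[of V m, OF V m] P[of W k, OF W k]
  note J = has_bochner_integral_add[OF has_bochner_integral_mult_right[OF I(1), of "1 - \<alpha>"] has_bochner_integral_mult_right[OF I(2), of \<alpha>]]
  have "(1 - \<alpha>) * (c * Re (qform (udiag n U (\<lambda>i. l i powr s)) v)) + \<alpha> * (c * Re (qform (udiag n V (\<lambda>i. m i powr s)) v))
    \<le> c * Re (qform (udiag n W (\<lambda>i. k i powr s)) v)"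
  proof (rule has_bochner_integral_mono[OF J I(3)])
    fix x :: real
    have 1: "exp x * resolvent n W k (exp x) v \<le> exp x * ((1 - \<alpha>) * resolvent n U l (exp x) v + \<alpha> * resolvent n V m (exp x) v)"
      using resolvent_le[OF _ v, of "exp x"] by simp
    have "(1 - \<alpha>) * (Re (cinner v v) - exp x * resolvent n U l (exp x) v) + \<alpha> * (Re (cinner v v) - exp x * resolvent n V m (exp x) v)
      \<le> Re (cinner v v) - exp x * resolvent n W k (exp x) v"
      using 1 by (simp add: algebra_simps)
    from mult_left_mono[OF this, of "exp (s * x)"]
    show "(1 - \<alpha>) * P U l x + \<alpha> * P V m x \<le> P W k x"
      unfolding P_def resolvent_kernel[where l=l, OF U l exp_gt_zero v] resolvent_kernel[where l=m, OF V m exp_gt_zero v]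
       resolvent_kernel[where l=k, OF W k exp_gt_zero v] by (simp add: algebra_simps)
  qed
  then have "c * ((1 - \<alpha>) * Re (qform (udiag n U (\<lambda>i. l i powr s)) v) + \<alpha> * Re (qform (udiag n V (\<lambda>i. m i powr s)) v))
    \<le> c * Re (qform (udiag n W (\<lambda>i. k i powr s)) v)" by (simp add: algebra_simps)
  then show ?thesis using c(1) by simp
qed

text \<open>Since \<open>t^s = t * t^(s - 1)\<close>, the kernel for the exponent
  \<open>s - 1\<close> is used with an extra factor \<open>t\<close>. Its linear term calls for the
  inequality opposite to \<open>le\<close>, hence the assumption \<open>eq\<close>.\<close>

lemma powr_convex_less_2:
  assumes eq: "\<And>u. dim_vec u = n \<Longrightarrow>
      (1 - \<alpha>) * Re (qform (udiag n U l) u) + \<alpha> * Re (qform (udiag n V m) u) = Re (qform (udiag n W k) u)"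
  assumes s: "1 < s" "s < 2" and v: "dim_vec v = n"
  shows "Re (qform (udiag n W (\<lambda>i. k i powr s)) v)
    \<le> (1 - \<alpha>) * Re (qform (udiag n U (\<lambda>i. l i powr s)) v) + \<alpha> * Re (qform (udiag n V (\<lambda>i. m i powr s)) v)"
proof -
  from s have "0 < s - 1" "s - 1 < 1" by auto
  from powr_kernel_integral[OF this] obtain c where c: "c > 0" "\<And>t. t \<ge> 0 \<Longrightarrow>
    has_bochner_integral lborel (\<lambda>x::real. exp ((s - 1) * x) * (t / (t + exp x))) (c * t powr (s - 1))" by blast
  define P where "P U l x = exp ((s - 1) * x) * (\<Sum>i<n. (cmod (ucoeff U v i))\<^sup>2 * l i * (l i / (l i + exp x)))" for U l x
  have P: "has_bochner_integral lborel (P U l) (c * Re (qform (udiag n U (\<lambda>i. l i powr s)) v))"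
    if "unitary n U" "\<forall>i<n. l i \<ge> 0" for U l
  proof -
    have "has_bochner_integral lborel (\<lambda>x. \<Sum>i<n. ((cmod (ucoeff U v i))\<^sup>2 * l i) * (exp ((s - 1) * x) * (l i / (l i + exp x))))
       (\<Sum>i<n. ((cmod (ucoeff U v i))\<^sup>2 * l i) * (c * l i powr (s - 1)))"
      using c(2) that by (intro has_bochner_integral_sum has_bochner_integral_mult_right) auto
    also have "(\<Sum>i<n. ((cmod (ucoeff U v i))\<^sup>2 * l i) * (c * l i powr (s - 1))) = c * Re (qform (udiag n U (\<lambda>i. l i powr s)) v)"
      unfolding Re_qform_udiag[OF unitaryD(1)[OF that(1)] v] sum_distrib_left
      using that(2) by (intro sum.cong refl) (auto simp: powr_mult_base[of _ "s - 1"] mult_ac)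
    finally show ?thesis unfolding P_def
      by (simp add: sum_distrib_left mult_ac)
  qed
  note I = P[of U l, OF U l] P[of V m, OF V m] P[of W k, OF W k]
  note J = has_bochner_integral_add[OF has_bochner_integral_mult_right[OF I(1), of "1 - \<alpha>"] has_bochner_integral_mult_right[OF I(2), of \<alpha>]]
  have "c * Re (qform (udiag n W (\<lambda>i. k i powr s)) v) \<le>
    (1 - \<alpha>) * (c * Re (qform (udiag n U (\<lambda>i. l i powr s)) v)) + \<alpha> * (c * Re (qform (udiag n V (\<lambda>i. m i powr s)) v))"
  proof (rule has_bochner_integral_mono[OF I(3) J])
    fix x :: real
    define \<mu> where "\<mu> = exp x"
    have \<mu>: "\<mu> > 0" by (simp add: \<mu>_def)
    have 1: "\<mu>\<^sup>2 * resolvent n W k \<mu> v \<le> \<mu>\<^sup>2 * ((1 - \<alpha>) * resolvent n U l \<mu> v + \<alpha> * resolvent n V m \<mu> v)"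
      using resolvent_le[OF \<mu> v] by (intro mult_left_mono) auto
    have "Re (qform (udiag n W k) v) - \<mu> * Re (cinner v v) + \<mu>\<^sup>2 * resolvent n W k \<mu> v \<le>
      (1 - \<alpha>) * (Re (qform (udiag n U l) v) - \<mu> * Re (cinner v v) + \<mu>\<^sup>2 * resolvent n U l \<mu> v) +
      \<alpha> * (Re (qform (udiag n V m) v) - \<mu> * Re (cinner v v) + \<mu>\<^sup>2 * resolvent n V m \<mu> v)"
      using 1 eq[OF v] by (simp add: algebra_simps)
    from mult_left_mono[OF this, of "exp ((s - 1) * x)"]
    show "P W k x \<le> (1 - \<alpha>) * P U l x + \<alpha> * P V m x"
      unfolding P_def \<mu>_def[symmetric] resolvent_kernel2[where l=l, OF U l \<mu> v] resolvent_kernel2[where l=m, OF V m \<mu> v]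
       resolvent_kernel2[where l=k, OF W k \<mu> v] by (simp add: algebra_simps)
  qed
  then have "c * Re (qform (udiag n W (\<lambda>i. k i powr s)) v) \<le> c * ((1 - \<alpha>) * Re (qform (udiag n U (\<lambda>i. l i powr s)) v) + \<alpha> * Re (qform (udiag n V (\<lambda>i. m i powr s)) v))"
    by (simp add: algebra_simps)
  then show ?thesis using c(1) by simp
qed

text \<open>The exponent 2 is reached as a limit from the left, because the form of a power is
  continuous in the exponent there.\<close>

lemma powr_convex:
  assumes eq: "\<And>u. dim_vec u = n \<Longrightarrow>
      (1 - \<alpha>) * Re (qform (udiag n U l) u) + \<alpha> * Re (qform (udiag n V m) u) = Re (qform (udiag n W k) u)"
  assumes s: "1 < s" "s \<le> 2" and v: "dim_vec v = n"
  shows "Re (qform (udiag n W (\<lambda>i. k i powr s)) v)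
    \<le> (1 - \<alpha>) * Re (qform (udiag n U (\<lambda>i. l i powr s)) v) + \<alpha> * Re (qform (udiag n V (\<lambda>i. m i powr s)) v)"
proof (cases "s = 2")
  case False
  then show ?thesis using powr_convex_less_2[OF eq s(1) _ v] s by simp
next
  case True
  have lim: "((\<lambda>r. Re (qform (udiag n U (\<lambda>i. l i powr r)) v)) \<longlongrightarrow> Re (qform (udiag n U (\<lambda>i. l i powr s)) v)) (at_left s)"
    if "unitary n U" for U and l :: "nat \<Rightarrow> real"
  proof -
    have *: "((\<lambda>r. x powr r) \<longlongrightarrow> x powr s) (at_left s)" for x :: real
      by (cases "x = 0") (auto intro!: tendsto_intros)
    then show ?thesis unfolding Re_qform_udiag[OF unitaryD(1)[OF that] v] by (intro tendsto_sum tendsto_mult tendsto_const *)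
  qed
  have ev: "eventually (\<lambda>r. Re (qform (udiag n W (\<lambda>i. k i powr r)) v)
    \<le> (1 - \<alpha>) * Re (qform (udiag n U (\<lambda>i. l i powr r)) v) + \<alpha> * Re (qform (udiag n V (\<lambda>i. m i powr r)) v)) (at_left s)"
    using eventually_at_left_real[OF s(1)]
    by eventually_elim (use True powr_convex_less_2[OF eq _ _ v] in auto)
  show ?thesis
    by (rule tendsto_le[OF _ _ lim[OF W] ev]) (auto intro!: tendsto_intros lim U V)
qed

end

section \<open>Operator concavity and convexity of powers\<close>

lemma qform_minus:
  assumes "X \<in> carrier_mat n n" "Y \<in> carrier_mat n n" "dim_vec v = n"
  shows "qform (X - Y) v = qform X v - qform Y v"
  using assms unfolding qform_def sum_subtractf[symmetric]
  by (intro sum.cong refl) (auto simp: algebra_simps)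

definition wmean :: "real \<Rightarrow> complex mat \<Rightarrow> complex mat \<Rightarrow> complex mat" where
  "wmean \<alpha> A B = complex_of_real (1 - \<alpha>) \<cdot>\<^sub>m A + complex_of_real \<alpha> \<cdot>\<^sub>m B"

lemma Re_qform_wmean:
  assumes "A \<in> carrier_mat n n" "B \<in> carrier_mat n n" "dim_vec v = n"
  shows "Re (qform (wmean \<alpha> A B) v) = (1 - \<alpha>) * Re (qform A v) + \<alpha> * Re (qform B v)"
proof -
  have "qform (wmean \<alpha> A B) v = complex_of_real (1 - \<alpha>) * qform A v + complex_of_real \<alpha> * qform B v"
    using assms unfolding qform_def sum_distrib_left sum.distrib[symmetric] wmean_def
    by (intro sum.cong refl) (auto simp: algebra_simps)
  then show ?thesis by simp
qed

lemma hermitianD: "hermitian n X \<Longrightarrow> i < n \<Longrightarrow> j < n \<Longrightarrow> cnj (X $$ (j,i)) = X $$ (i,j)"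
  unfolding hermitian_def by (metis cadj_index carrier_matD)

lemma hermitian_carrier: "hermitian n X \<Longrightarrow> X \<in> carrier_mat n n"
  unfolding hermitian_def by simp

lemma hermitian_minus: "hermitian n X \<Longrightarrow> hermitian n Y \<Longrightarrow> hermitian n (X - Y)"
  using hermitianD[of n X] hermitianD[of n Y]
  unfolding hermitian_def by (auto intro!: eq_matI)

lemma hermitian_wmean: "hermitian n X \<Longrightarrow> hermitian n Y \<Longrightarrow> hermitian n (wmean \<alpha> X Y)"
  using hermitianD[of n X] hermitianD[of n Y]
  unfolding hermitian_def wmean_def by (auto intro!: eq_matI)

lemma psd_wmean:
  assumes "psd n X" "psd n Y" "0 \<le> \<alpha>" "\<alpha> \<le> 1"
  shows "psd n (wmean \<alpha> X Y)"
  using assms unfolding psd_def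
  by (auto simp: hermitian_wmean Re_qform_wmean[of _ n] hermitian_carrier)

lemma loewner_le_iff:
  assumes "hermitian n X" "hermitian n Y"
  shows "loewner_le n X Y \<longleftrightarrow> (\<forall>v. dim_vec v = n \<longrightarrow> Re (qform X v) \<le> Re (qform Y v))"
  using assms unfolding loewner_le_def psd_def
  by (auto simp: hermitian_minus hermitian_carrier qform_minus[of _ n])

lemma psd_mpow: "psd n A \<Longrightarrow> psd n (mpow A p)"
  by (elim psd_spectral) (auto simp: mpow_udiag intro!: psd_udiag dest: unitaryD)

lemma mpow_mpow:
  assumes "psd n A" shows "mpow (mpow A p) q = mpow A (p * q)"
  using assms by (elim psd_spectral) (simp add: mpow_udiag powr_powr)

lemma udiag_cong: "(\<And>i. i < n \<Longrightarrow> f i = g i) \<Longrightarrow> udiag n U f = udiag n U g"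
  unfolding udiag_def mat_diag_def by (intro arg_cong2[where f="(*)"] refl eq_matI) auto

lemma mpow_1:
  assumes "psd n A" shows "mpow A 1 = A"
  using assms by (elim psd_spectral) (auto simp: mpow_udiag powr_one intro!: udiag_cong)

lemma powmean_eq: "powmean \<alpha> p A B = mpow (wmean \<alpha> (mpow A p) (mpow B p)) (1 / p)"
  unfolding powmean_def wmean_def ..

lemma psd_powmean:
  assumes "psd n A" "psd n B" "0 \<le> \<alpha>" "\<alpha> \<le> 1"
  shows "psd n (powmean \<alpha> p A B)"
  unfolding powmean_eq using assms by (intro psd_mpow psd_wmean)

text \<open>\<open>C\<close> is not tied to the mean of \<open>A\<close> and \<open>B\<close>, so
  that operator monotonicity becomes a special case.\<close>

lemma mpow_concave:
  assumes A: "psd n A" and B: "psd n B" and C: "psd n C" and \<alpha>: "0 \<le> \<alpha>" "\<alpha> \<le> 1" and s: "0 < s" "s \<le> 1"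
    and le: "loewner_le n (wmean \<alpha> A B) C"
  shows "loewner_le n (wmean \<alpha> (mpow A s) (mpow B s)) (mpow C s)"
proof -
  obtain U l where sU: "unitary n U" "\<forall>i<n. l i \<ge> 0" "A = udiag n U l" using psd_spectral[OF A] .
  obtain V m where sV: "unitary n V" "\<forall>i<n. m i \<ge> 0" "B = udiag n V m" using psd_spectral[OF B] .
  obtain W k where sW: "unitary n W" "\<forall>i<n. k i \<ge> 0" "C = udiag n W k" using psd_spectral[OF C] .
  note c = unitaryD(1)[OF sU(1)] unitaryD(1)[OF sV(1)] unitaryD(1)[OF sW(1)]
  have "loewner_le n (wmean \<alpha> (udiag n U l) (udiag n V m)) (udiag n W k)" using le sU(3) sV(3) sW(3) by simp
  then have "\<forall>u. dim_vec u = n \<longrightarrow> Re (qform (wmean \<alpha> (udiag n U l) (udiag n V m)) u) \<le> Re (qform (udiag n W k) u)"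
    by (subst (asm) loewner_le_iff) (intro hermitian_wmean hermitian_udiag c)+
  then have le': "(1 - \<alpha>) * Re (qform (udiag n U l) u) + \<alpha> * Re (qform (udiag n V m) u) \<le> Re (qform (udiag n W k) u)"
    if "dim_vec u = n" for u
    using that c by (simp add: Re_qform_wmean[of _ n])
  interpret spectral_triple n U V W l m k \<alpha>
    by standard (use sU sV sW \<alpha> le' in auto)
  have "(1 - \<alpha>) * Re (qform (mpow A s) v) + \<alpha> * Re (qform (mpow B s) v) \<le> Re (qform (mpow C s) v)"
    if "dim_vec v = n" for v
    using powr_concave[OF s that] sU sV sW by (simp add: mpow_udiag)
  then show ?thesis
    using psd_mpow[OF A, of s] psd_mpow[OF B, of s] psd_mpow[OF C, of s] unfolding psd_def
    by (subst loewner_le_iff) (simp_all add: hermitian_wmean Re_qform_wmean[of _ n] hermitian_carrier)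
qed

text \<open>Here the third matrix of the locale is the mean itself, so that \<open>le\<close> holds
  with equality, as \<open>powr_convex\<close> demands.\<close>

lemma mpow_convex:
  assumes A: "psd n A" and B: "psd n B" and \<alpha>: "0 \<le> \<alpha>" "\<alpha> \<le> 1" and s: "1 < s" "s \<le> 2"
  shows "loewner_le n (mpow (wmean \<alpha> A B) s) (wmean \<alpha> (mpow A s) (mpow B s))"
proof -
  have C: "psd n (wmean \<alpha> A B)" using A B \<alpha> by (rule psd_wmean)
  obtain U l where sU: "unitary n U" "\<forall>i<n. l i \<ge> 0" "A = udiag n U l" using psd_spectral[OF A] .
  obtain V m where sV: "unitary n V" "\<forall>i<n. m i \<ge> 0" "B = udiag n V m" using psd_spectral[OF B] .
  obtain W k where sW: "unitary n W" "\<forall>i<n. k i \<ge> 0" "wmean \<alpha> A B = udiag n W k" using psd_spectral[OF C] .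
  note c = unitaryD(1)[OF sU(1)] unitaryD(1)[OF sV(1)] unitaryD(1)[OF sW(1)]
  have eq: "(1 - \<alpha>) * Re (qform (udiag n U l) u) + \<alpha> * Re (qform (udiag n V m) u) = Re (qform (udiag n W k) u)" if "dim_vec u = n" for u
    using that c unfolding sW(3)[symmetric] sU(3) sV(3) by (simp add: Re_qform_wmean[of _ n])
  interpret spectral_triple n U V W l m k \<alpha>
    by standard (use sU sV sW \<alpha> eq in auto)
  have "Re (qform (mpow (wmean \<alpha> A B) s) v) \<le> (1 - \<alpha>) * Re (qform (mpow A s) v) + \<alpha> * Re (qform (mpow B s) v)"
    if "dim_vec v = n" for v
    using powr_convex[OF eq s that] sU(1,2) sV(1,2) sW(1,2) unfolding sW(3) unfolding sU(3) sV(3) by (simp add: mpow_udiag)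
  then show ?thesis
    using psd_mpow[OF A, of s] psd_mpow[OF B, of s] psd_mpow[OF C, of s] unfolding psd_def
    by (subst loewner_le_iff) (simp_all add: hermitian_wmean Re_qform_wmean[of _ n] hermitian_carrier)
qed

lemma wmean_idem: "X \<in> carrier_mat n n \<Longrightarrow> wmean \<alpha> X X = X"
  unfolding wmean_def by (intro eq_matI) (auto simp flip: ring_distribs)

text \<open>The case \<open>B = A\<close> of \<open>mpow_concave\<close>, where every weighted mean
  collapses to \<open>A\<close>; the weight 0 is an arbitrary choice.\<close>

lemma mpow_mono:
  assumes "psd n A" "psd n C" "0 < s" "s \<le> 1" "loewner_le n A C"
  shows "loewner_le n (mpow A s) (mpow C s)"
  using mpow_concave[of n A A C 0 s] assms psd_mpow[of n A s]
  by (simp add: wmean_idem[of _ n] hermitian_carrier psd_def)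

section \<open>Sufficiency of the exponent conditions\<close>

lemma powmean_mono_ge_1:
  assumes A: "psd n A" and B: "psd n B" and \<alpha>: "0 \<le> \<alpha>" "\<alpha> \<le> 1" and pq: "1 \<le> p" "p \<le> q"
  shows "loewner_le n (powmean \<alpha> p A B) (powmean \<alpha> q A B)"
proof -
  let ?Y = "wmean \<alpha> (mpow A q) (mpow B q)"
  have Y: "psd n ?Y" using A B \<alpha> by (intro psd_wmean psd_mpow)
  have h: "hermitian n ?Y" "?Y \<in> carrier_mat n n" using Y by (auto simp: psd_def hermitian_def)
  \<comment> \<open>Concavity of the power \<open>p / q\<close> is used with \<open>C = ?Y\<close>,
    for which its hypothesis is reflexivity.\<close>
  have "loewner_le n ?Y ?Y" using h by (simp add: loewner_le_iff)
  then have "loewner_le n (wmean \<alpha> (mpow (mpow A q) (p / q)) (mpow (mpow B q) (p / q))) (mpow ?Y (p / q))"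
    using pq A B Y \<alpha> by (intro mpow_concave psd_mpow) auto
  then have "loewner_le n (wmean \<alpha> (mpow A p) (mpow B p)) (mpow ?Y (p / q))"
    using pq A B by (simp add: mpow_mpow)
  \<comment> \<open>The outer power is monotone because \<open>1 / p \<le> 1\<close>; this is where
    \<open>1 \<le> p\<close> enters.\<close>
  then have "loewner_le n (mpow (wmean \<alpha> (mpow A p) (mpow B p)) (1 / p)) (mpow (mpow ?Y (p / q)) (1 / p))"
    using pq A B Y \<alpha> by (intro mpow_mono psd_mpow psd_wmean) auto
  then show ?thesis using pq Y by (simp add: powmean_eq mpow_mpow)
qed

text \<open>Operator convexity of the power \<open>1 / p\<close>, applied to \<open>A^p\<close> and
  \<open>B^p\<close>; the bounds on \<open>p\<close> say that this exponent lies in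
  \<open>(1, 2]\<close>.\<close>

lemma powmean_le_1:
  assumes A: "psd n A" and B: "psd n B" and \<alpha>: "0 \<le> \<alpha>" "\<alpha> \<le> 1" and p: "1 / 2 \<le> p" "p < 1"
  shows "loewner_le n (powmean \<alpha> p A B) (powmean \<alpha> 1 A B)"
proof -
  have "loewner_le n (mpow (wmean \<alpha> (mpow A p) (mpow B p)) (1 / p))
      (wmean \<alpha> (mpow (mpow A p) (1 / p)) (mpow (mpow B p) (1 / p)))"
    using p A B \<alpha> by (intro mpow_convex psd_mpow) (auto simp: field_simps)
  then show ?thesis using p A B \<alpha> by (simp add: powmean_eq mpow_mpow mpow_1[of n] psd_wmean)
qed

lemma loewner_le_trans:
  assumes "psd n X" "psd n Y" "psd n Z" "loewner_le n X Y" "loewner_le n Y Z"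
  shows "loewner_le n X Z"
  using assms loewner_le_iff[of n X Y] loewner_le_iff[of n Y Z] loewner_le_iff[of n X Z]
  unfolding psd_def by (meson order_trans)

lemma powmean_mono:
  assumes A: "psd n A" and B: "psd n B" and \<alpha>: "0 \<le> \<alpha>" "\<alpha> \<le> 1"
    and pq: "p = q \<or> (1 \<le> p \<and> p < q) \<or> (1 / 2 \<le> p \<and> p < 1 \<and> 1 \<le> q)"
  shows "loewner_le n (powmean \<alpha> p A B) (powmean \<alpha> q A B)"
  using pq
proof (elim disjE conjE)
  assume "p = q"
  then show ?thesis using psd_powmean[OF A B \<alpha>, of q] by (auto simp: psd_def loewner_le_iff)
next
  assume "1 / 2 \<le> p" "p < 1" "1 \<le> q"
  then show ?thesis
    using loewner_le_trans[OF psd_powmean[OF A B \<alpha>] psd_powmean[OF A B \<alpha>] psd_powmean[OF A B \<alpha>]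
      powmean_le_1[OF A B \<alpha>] powmean_mono_ge_1[OF A B \<alpha>, of 1 q]] by simp
qed (auto intro: powmean_mono_ge_1 A B \<alpha>)

section \<open>Powers of real two-by-two matrices\<close>

definition sym_mat2 :: "real \<Rightarrow> real \<Rightarrow> real \<Rightarrow> complex mat" where
  "sym_mat2 a b c = mat 2 2 (\<lambda>(i,j). complex_of_real (if i \<noteq> j then b else if i = 0 then a else c))"

lemma sym_mat2_carrier [simp]: "sym_mat2 a b c \<in> carrier_mat 2 2"
  unfolding sym_mat2_def by simp

lemma sym_mat2_index [simp]:
  "sym_mat2 a b c $$ (0,0) = a" "sym_mat2 a b c $$ (0,Suc 0) = b" "sym_mat2 a b c $$ (Suc 0,0) = b" "sym_mat2 a b c $$ (Suc 0,Suc 0) = c"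
  unfolding sym_mat2_def by auto

lemma less_2_iff: "(i::nat) < 2 \<longleftrightarrow> i = 0 \<or> i = 1" by auto

lemma eq_sym_mat2I:
  assumes "X \<in> carrier_mat 2 2" "X $$ (0,0) = complex_of_real a" "X $$ (0,1) = complex_of_real b"
    "X $$ (1,0) = complex_of_real b" "X $$ (1,1) = complex_of_real c"
  shows "X = sym_mat2 a b c"
  using assms unfolding sym_mat2_def by (intro eq_matI) (auto simp: less_2_iff)

lemma hermitian_sym_mat2: "hermitian 2 (sym_mat2 a b c)"
  unfolding hermitian_def by (auto intro!: eq_matI simp: cadj_def sym_mat2_def)

lemma wmean_sym_mat2: "wmean \<alpha> (sym_mat2 a b c) (sym_mat2 a' b' c') =
  sym_mat2 ((1 - \<alpha>) * a + \<alpha> * a') ((1 - \<alpha>) * b + \<alpha> * b') ((1 - \<alpha>) * c + \<alpha> * c')"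
  unfolding wmean_def by (rule eq_sym_mat2I) (auto simp: sym_mat2_def)

lemma Re_qform_sym_mat2:
  assumes "dim_vec v = 2"
  shows "Re (qform (sym_mat2 a b c) v) = a * (cmod (v $ 0))\<^sup>2 + 2 * b * Re (cnj (v $ 0) * v $ 1) + c * (cmod (v $ 1))\<^sup>2"
proof -
  have s: "(\<Sum>i<2. f i) = f 0 + f (Suc 0)" for f :: "nat \<Rightarrow> complex" by (simp add: numeral_2_eq_2)
  show ?thesis unfolding qform_def assms s
    by (simp add: cmod_power2 algebra_simps) (simp add: power2_eq_square algebra_simps)
qed

text \<open>Sylvester's criterion in size two. Necessity tests two vectors; sufficiency multiplies
  the form by \<open>a\<close> and completes the square.\<close>

lemma pd_sym_mat2_iff: "pd 2 (sym_mat2 a b c) \<longleftrightarrow> a > 0 \<and> a * c - b\<^sup>2 > 0"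
proof (intro iffI conjI; (elim conjE)?)
  assume pd: "pd 2 (sym_mat2 a b c)"
  have *: "a * (cmod x)\<^sup>2 + 2 * b * Re (cnj x * y) + c * (cmod y)\<^sup>2 > 0" if "x \<noteq> 0 \<or> y \<noteq> 0" for x y
  proof -
    let ?v = "vec 2 (\<lambda>i. if i = 0 then x else y)"
    have "?v \<noteq> 0\<^sub>v 2"
    proof
      assume "?v = 0\<^sub>v 2"
      then have "?v $ 0 = 0\<^sub>v 2 $ 0" "?v $ 1 = 0\<^sub>v 2 $ 1" by simp_all
      then show False using that by simp
    qed
    then have "Re (qform (sym_mat2 a b c) ?v) > 0" using pd unfolding pd_def by simp
    then show ?thesis by (subst (asm) Re_qform_sym_mat2) auto
  qed
  show a: "a > 0" using *[of 1 0] by simp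
  \<comment> \<open>At the vector \<open>(b, -a)\<close> the form equals \<open>a\<close> times the
    determinant.\<close>
  have "a * (a * c - b\<^sup>2) > 0" using *[of "complex_of_real b" "complex_of_real (- a)"] a
    by (simp add: power2_eq_square algebra_simps)
  then show "a * c - b\<^sup>2 > 0" using a by (simp add: zero_less_mult_iff)
next
  assume a: "a > 0" and d: "a * c - b\<^sup>2 > 0"
  show "pd 2 (sym_mat2 a b c)" unfolding pd_def
  proof (intro conjI allI impI hermitian_sym_mat2)
    fix v :: "complex vec" assume v: "dim_vec v = 2 \<and> v \<noteq> 0\<^sub>v 2"
    define x where "x = v $ 0"
    define y where "y = v $ 1"
    have xy: "x \<noteq> 0 \<or> y \<noteq> 0"
    proof (rule ccontr)
      assume "\<not> ?thesis"
      then have "v = 0\<^sub>v 2" using v unfolding x_def y_def by (intro eq_vecI) (auto simp: less_2_iff)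
      then show False using v by simp
    qed
    have "a * (a * (cmod x)\<^sup>2 + 2 * b * Re (cnj x * y) + c * (cmod y)\<^sup>2) = (cmod (a * x + b * y))\<^sup>2 + (a * c - b\<^sup>2) * (cmod y)\<^sup>2"
      by (simp add: cmod_power2) (simp add: power2_eq_square algebra_simps)
    then have "a * Re (qform (sym_mat2 a b c) v) = (cmod (a * x + b * y))\<^sup>2 + (a * c - b\<^sup>2) * (cmod y)\<^sup>2"
      using v by (simp only: Re_qform_sym_mat2 x_def[symmetric] y_def[symmetric])
    also have "\<dots> > 0"
    proof (cases "y = 0")
      case True
      then show ?thesis using xy a by simp
    next
      case False
      then show ?thesis using d by (simp add: add_nonneg_pos)
    qed
    finally show "Re (qform (sym_mat2 a b c) v) > 0" using a by (simp add: zero_less_mult_iff)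
  qed
qed

lemma pd_imp_psd: "pd n A \<Longrightarrow> psd n A"
  unfolding pd_def psd_def
proof (intro conjI allI impI; elim conjE)
  fix v :: "complex vec" assume *: "\<forall>v. dim_vec v = n \<and> v \<noteq> 0\<^sub>v n \<longrightarrow> 0 < Re (qform A v)" "dim_vec v = n"
  show "0 \<le> Re (qform A v)"
  proof (cases "v = 0\<^sub>v n")
    case True
    then show ?thesis by (simp add: qform_def)
  next
    case False
    then show ?thesis using * by (simp add: less_imp_le)
  qed
qed

lemma pd_wmean:
  assumes "pd n X" "pd n Y" "0 < \<alpha>" "\<alpha> < 1"
  shows "pd n (wmean \<alpha> X Y)"
proof -
  have h: "hermitian n X" "hermitian n Y" using assms unfolding pd_def by auto
  show ?thesis using assms h unfolding pd_def
    by (simp add: hermitian_wmean Re_qform_wmean[of _ n] hermitian_carrier add_pos_pos)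
qed

section \<open>Eigenvalues of real symmetric two-by-two matrices, and powers by
  interpolation\<close>

definition eig_max :: "real \<Rightarrow> real \<Rightarrow> real \<Rightarrow> real" where
  "eig_max a b c = (a + c + sqrt ((a - c)\<^sup>2 + 4 * b\<^sup>2)) / 2"

definition eig_min :: "real \<Rightarrow> real \<Rightarrow> real \<Rightarrow> real" where
  "eig_min a b c = (a + c - sqrt ((a - c)\<^sup>2 + 4 * b\<^sup>2)) / 2"

lemma eig_sum: "eig_max a b c + eig_min a b c = a + c"
  unfolding eig_max_def eig_min_def by (simp add: field_simps)

lemma eig_prod: "eig_max a b c * eig_min a b c = a * c - b\<^sup>2"
proof -
  have "(sqrt ((a - c)\<^sup>2 + 4 * b\<^sup>2))\<^sup>2 = (a - c)\<^sup>2 + 4 * b\<^sup>2" by simp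
  moreover have "eig_max a b c * eig_min a b c = ((a + c)\<^sup>2 - (sqrt ((a - c)\<^sup>2 + 4 * b\<^sup>2))\<^sup>2) / 4"
    unfolding eig_max_def eig_min_def by (simp only: power2_eq_square) (simp add: field_simps)
  ultimately show ?thesis by (simp only:) (simp add: power2_eq_square field_simps)
qed

lemma eig_max_gt_min: "b \<noteq> 0 \<Longrightarrow> eig_max a b c > eig_min a b c"
  unfolding eig_max_def eig_min_def by (simp add: add_nonneg_pos)

lemma eig_max_gt_diag:
  assumes "b \<noteq> 0" shows "eig_max a b c > a" "eig_max a b c > c"
proof -
  have "sqrt ((a - c)\<^sup>2 + 4 * b\<^sup>2) > sqrt ((a - c)\<^sup>2)" using assms by (intro real_sqrt_less_mono) simp
  then have "sqrt ((a - c)\<^sup>2 + 4 * b\<^sup>2) > \<bar>a - c\<bar>" by simp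
  then show "eig_max a b c > a" "eig_max a b c > c" unfolding eig_max_def by (auto simp: field_simps)
qed

lemma eig_min_pos:
  assumes "b \<noteq> 0" "a > 0" "a * c - b\<^sup>2 > 0" shows "eig_min a b c > 0"
proof -
  have "eig_max a b c > 0" using eig_max_gt_diag(1)[OF assms(1), of a c] assms by simp
  moreover have "eig_max a b c * eig_min a b c > 0" using eig_prod[of a b c] assms by simp
  ultimately show ?thesis by (simp add: zero_less_mult_iff)
qed

text \<open>The line through the two points of the graph of \<open>t\<^sup>r\<close> above the eigenvalues; evaluating it at the
  matrix gives the \<open>r\<close>-th power. It is junk if the eigenvalues coincide.\<close>

definition powr_slope :: "real \<Rightarrow> real \<Rightarrow> real \<Rightarrow> real \<Rightarrow> real" where
  "powr_slope r a b c = (eig_max a b c powr r - eig_min a b c powr r) / (eig_max a b c - eig_min a b c)"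

definition powr_icpt :: "real \<Rightarrow> real \<Rightarrow> real \<Rightarrow> real \<Rightarrow> real" where
  "powr_icpt r a b c = eig_max a b c powr r - powr_slope r a b c * eig_max a b c"

lemma powr_interp_max: "powr_slope r a b c * eig_max a b c + powr_icpt r a b c = eig_max a b c powr r"
  unfolding powr_icpt_def by simp

lemma powr_interp_min:
  assumes "b \<noteq> 0" shows "powr_slope r a b c * eig_min a b c + powr_icpt r a b c = eig_min a b c powr r"
proof -
  have "powr_slope r a b c * (eig_max a b c - eig_min a b c) = eig_max a b c powr r - eig_min a b c powr r"
    using eig_max_gt_min[OF assms, of a c] unfolding powr_slope_def by simp
  then show ?thesis unfolding powr_icpt_def by (simp add: algebra_simps)
qed

text \<open>The constant contributes \<open>E\<close> times \<open>U * cadj U\<close>, the identity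
  matrix, so an affine function of the eigenvalues is the same affine function of the
  matrix.\<close>

lemma udiag_affine:
  assumes "unitary n U" "i < n" "j < n"
  shows "udiag n U (\<lambda>k. D * f k + E) $$ (i,j) = D * udiag n U f $$ (i,j) + E * (if i = j then 1 else 0)"
proof -
  note c = unitaryD[OF assms(1)]
  have "(\<Sum>k<n. U $$ (i,k) * cnj (U $$ (j,k))) = (U * cadj U) $$ (i,j)"
    using assms c(1) by (auto simp: scalar_prod_def atLeast0LessThan intro!: sum.cong)
  then have "(\<Sum>k<n. U $$ (i,k) * cnj (U $$ (j,k))) = (if i = j then 1 else 0)" using assms c by simp
  moreover have "udiag n U (\<lambda>k. D * f k + E) $$ (i,j) = D * udiag n U f $$ (i,j) + E * (\<Sum>k<n. U $$ (i,k) * cnj (U $$ (j,k)))"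
    using assms c(1) by (simp add: udiag_index sum_distrib_left sum.distrib algebra_simps)
  ultimately show ?thesis by simp
qed

text \<open>Column \<open>k\<close> of \<open>U\<close> is a nonzero eigenvector for
  \<open>l k\<close>, so \<open>l k\<close> is a root of the characteristic polynomial, which is
  factored by trace and determinant.\<close>

lemma eigenvalue_sym_mat2:
  assumes U: "unitary 2 U" and M: "sym_mat2 a b c = udiag 2 U l" and k: "k < 2"
  shows "l k = eig_max a b c \<or> l k = eig_min a b c"
proof -
  note d = unitaryD[OF U]
  let ?D = "mat_diag 2 (\<lambda>i. complex_of_real (l i))"
  have s: "(\<Sum>i\<in>{0..<2}. f i) = f 0 + f (Suc 0)" for f :: "nat \<Rightarrow> complex" by (simp add: numeral_2_eq_2)
  have "sym_mat2 a b c * U = U * ?D * (cadj U * U)"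
    unfolding M udiag_def using d(1) by (simp add: sq_assoc[of _ 2] sq_mult[of _ 2])
  then have e: "sym_mat2 a b c * U = U * ?D" using d by (simp add: sq_mult[of _ 2] right_mult_one_mat[of _ 2 2])
  define x where "x = U $$ (0,k)"
  define y where "y = U $$ (1,k)"
  have 1: "(sym_mat2 a b c * U) $$ (i,k) = U $$ (i,k) * l k" if "i < 2" for i
    unfolding e mat_diag_mult_right[OF d(1)] using that k by simp
  have 2: "a * x + b * y = x * l k" "b * x + c * y = y * l k"
    using 1[of 0] 1[of 1] k d(1) unfolding x_def y_def by (auto simp: scalar_prod_def s sym_mat2_def)
  have "(cadj U * U) $$ (k,k) = cnj x * x + cnj y * y"
    using k d(1) unfolding x_def y_def by (auto simp: scalar_prod_def s)
  then have 3: "x \<noteq> 0 \<or> y \<noteq> 0" using d k by auto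
  define L where "L = complex_of_real (l k)"
  \<comment> \<open>Eliminating either coordinate from the eigenvector equations shows that the
    determinant annihilates the other one.\<close>
  have 4: "((a - L) * (c - L) - b * b) * x = 0" "((a - L) * (c - L) - b * b) * y = 0"
  proof -
    have x: "(a - L) * x = - (b * y)" and y: "(c - L) * y = - (b * x)"
      using 2 unfolding L_def by (auto simp: algebra_simps)
    have "((a - L) * (c - L) - b * b) * x = (c - L) * ((a - L) * x) - b * b * x" by (simp add: algebra_simps)
    also have "\<dots> = - b * ((c - L) * y) - b * b * x" unfolding x by (simp add: algebra_simps)
    finally show "((a - L) * (c - L) - b * b) * x = 0" unfolding y by simp
    have "((a - L) * (c - L) - b * b) * y = (a - L) * ((c - L) * y) - b * b * y" by (simp add: algebra_simps)
    also have "\<dots> = - b * ((a - L) * x) - b * b * y" unfolding y by (simp add: algebra_simps)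
    finally show "((a - L) * (c - L) - b * b) * y = 0" unfolding x by simp
  qed
  have "complex_of_real ((a - l k) * (c - l k) - b * b) = 0" using 3 4 unfolding L_def by auto
  then have "(a - l k) * (c - l k) - b\<^sup>2 = 0" unfolding of_real_eq_0_iff power2_eq_square .
  moreover have "(l k - eig_max a b c) * (l k - eig_min a b c) = l k * l k - (eig_max a b c + eig_min a b c) * l k + eig_max a b c * eig_min a b c"
    by (simp add: algebra_simps)
  ultimately have "(l k - eig_max a b c) * (l k - eig_min a b c) = 0"
    unfolding eig_sum eig_prod by (simp add: algebra_simps)
  then show ?thesis by auto
qed

text \<open>On the two-point spectrum \<open>t^r\<close> agrees with an affine function;
  \<open>b \<noteq> 0\<close> keeps the eigenvalues apart.\<close>

lemma mpow_sym_mat2: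
  assumes psd: "psd 2 (sym_mat2 a b c)" and b: "b \<noteq> 0"
  shows "mpow (sym_mat2 a b c) r = sym_mat2 (powr_slope r a b c * a + powr_icpt r a b c) (powr_slope r a b c * b) (powr_slope r a b c * c + powr_icpt r a b c)"
proof -
  let ?D = "powr_slope r a b c" and ?E = "powr_icpt r a b c"
  obtain U l where U: "unitary 2 U" "\<forall>i<2. l i \<ge> 0" "sym_mat2 a b c = udiag 2 U l" using psd_spectral[OF psd] .
  have "mpow (sym_mat2 a b c) r = udiag 2 U (\<lambda>k. l k powr r)" using U by (simp add: mpow_udiag)
  also have "\<dots> = udiag 2 U (\<lambda>k. ?D * l k + ?E)"
  proof (rule udiag_cong)
    fix k :: nat assume "k < 2"
    then show "l k powr r = ?D * l k + ?E"
      using eigenvalue_sym_mat2[OF U(1,3), of k] powr_interp_max[of r a b c] powr_interp_min[OF b, of r a c] by auto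
  qed
  also have "\<dots> = sym_mat2 (?D * a + ?E) (?D * b) (?D * c + ?E)"
    using unitaryD(1)[OF U(1)] by (intro eq_sym_mat2I) (auto simp: udiag_affine[OF U(1)] U(3)[symmetric])
  finally show ?thesis .
qed

text \<open>Covers \<open>b = 0\<close>, where the interpolating line is junk if
  \<open>a = c\<close>; the identity matrix already diagonalises.\<close>

lemma mpow_sym_mat2_diag:
  assumes "a \<ge> 0" "c \<ge> 0"
  shows "mpow (sym_mat2 a 0 c) r = sym_mat2 (a powr r) 0 (c powr r)"
proof -
  have u: "unitary 2 (1\<^sub>m 2)" unfolding unitary_def by (auto intro!: eq_matI)
  have eq: "udiag 2 (1\<^sub>m 2) (\<lambda>k. if k = 0 then a else c) = sym_mat2 a 0 c" for a c
    by (rule eq_sym_mat2I) (auto simp: udiag_index numeral_2_eq_2)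
  have "mpow (udiag 2 (1\<^sub>m 2) (\<lambda>k. if k = 0 then a else c)) r = udiag 2 (1\<^sub>m 2) (\<lambda>k. (if k = 0 then a else c) powr r)"
    using assms u by (intro mpow_udiag) auto
  also have "(\<lambda>k. (if k = 0 then a else c) powr r) = (\<lambda>k::nat. if k = 0 then a powr r else c powr r)" by auto
  finally show ?thesis unfolding eq .
qed

lemma eig_bounds:
  assumes "pd 2 (sym_mat2 a b c)" and b: "b \<noteq> 0"
  shows "eig_min a b c > 0" "eig_max a b c > eig_min a b c" "eig_max a b c > a" "eig_max a b c > c" "a > eig_min a b c" "c > eig_min a b c" "c > 0"
proof -
  have ac: "a > 0" "a * c - b\<^sup>2 > 0" using assms pd_sym_mat2_iff by auto
  show "eig_min a b c > 0" "eig_max a b c > eig_min a b c" "eig_max a b c > a" "eig_max a b c > c"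
    using eig_min_pos[OF b ac] eig_max_gt_min[OF b] eig_max_gt_diag[OF b] by auto
  then show "a > eig_min a b c" "c > eig_min a b c" "c > 0" using eig_sum[of a b c] by linarith+
qed

text \<open>By the determinant criterion: the upper diagonal entry of the power is a convex
  combination of the powers of the eigenvalues, and its determinant is their product.\<close>

lemma pd_mpow_sym_mat2:
  assumes "pd 2 (sym_mat2 a b c)" and b: "b \<noteq> 0"
  shows "pd 2 (mpow (sym_mat2 a b c) r)"
proof -
  define D where "D = powr_slope r a b c"
  define E where "E = powr_icpt r a b c"
  define h where "h = eig_max a b c"
  define l where "l = eig_min a b c"
  note f = eig_bounds[OF assms, folded h_def l_def]
  have Dh: "D * h + E = h powr r" and Dl: "D * l + E = l powr r"
    using powr_interp_max[of r a b c] powr_interp_min[OF b, of r a c] unfolding D_def E_def h_def l_def by auto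
  have "(h - l) * (D * a + E) = (a - l) * (D * h + E) + (h - a) * (D * l + E)" by (simp add: algebra_simps)
  also have "\<dots> > 0" unfolding Dh Dl using f by (intro add_pos_pos mult_pos_pos) auto
  finally have 1: "D * a + E > 0" using f by (simp add: zero_less_mult_iff)
  have "(D * a + E) * (D * c + E) - (D * b)\<^sup>2 = (D * h + E) * (D * l + E)"
  proof -
    have "(D * a + E) * (D * c + E) - (D * b)\<^sup>2 = D\<^sup>2 * (a * c - b\<^sup>2) + D * E * (a + c) + E\<^sup>2"
      by (simp add: power2_eq_square algebra_simps)
    also have "\<dots> = D\<^sup>2 * (h * l) + D * E * (h + l) + E\<^sup>2" unfolding h_def l_def eig_sum eig_prod ..
    finally show ?thesis by (simp add: power2_eq_square algebra_simps)
  qed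
  also have "\<dots> > 0" unfolding Dh Dl using f by (intro mult_pos_pos) auto
  finally show ?thesis using 1 by (simp add: mpow_sym_mat2[OF pd_imp_psd[OF assms(1)] b] pd_sym_mat2_iff D_def E_def)
qed

text \<open>The spectral part belonging to the larger eigenvalue alone already contributes the left-hand side.\<close>

lemma mpow_sym_mat2_lower_bound:
  assumes "pd 2 (sym_mat2 a b c)"
  shows "eig_max a b c powr (r - 2) * b\<^sup>2 \<le> Re (mpow (sym_mat2 a b c) r $$ (1,1))"
proof (cases "b = 0")
  case True
  have "c \<ge> 0" "a \<ge> 0" using assms True by (auto simp: pd_sym_mat2_iff zero_less_mult_iff)
  then show ?thesis using True by (simp add: mpow_sym_mat2_diag)
next
  case b: False
  define D where "D = powr_slope r a b c"
  define E where "E = powr_icpt r a b c"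
  define h where "h = eig_max a b c"
  define l where "l = eig_min a b c"
  note f = eig_bounds[OF assms b, folded h_def l_def]
  have Dh: "D * h + E = h powr r" and Dl: "D * l + E = l powr r"
    using powr_interp_max[of r a b c] powr_interp_min[OF b, of r a c] unfolding D_def E_def h_def l_def by auto
  \<comment> \<open>By trace and determinant this product is \<open>b^2\<close>. So the weight
    \<open>(c - l) / (h - l)\<close> of the larger eigenvalue is \<open>b^2\<close> over
    \<open>(h - c) * (h - l)\<close>, a denominator that is at most \<open>h^2\<close>.\<close>
  have "(h - c) * (c - l) = c * (h + l) - h * l - c * c" by (simp add: algebra_simps)
  then have cl: "(h - c) * (c - l) = b\<^sup>2"
    unfolding h_def l_def eig_sum eig_prod by (simp add: algebra_simps)
  have "(h - l) * (D * c + E) = (c - l) * (D * h + E) + (h - c) * (D * l + E)" by (simp add: algebra_simps)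
  also have "\<dots> \<ge> (c - l) * h powr r" unfolding Dh Dl using f by simp
  finally have 0: "(c - l) * h powr r \<le> (h - l) * (D * c + E)" .
  moreover have "0 < (c - l) * h powr r" using f by (intro mult_pos_pos) auto
  ultimately have "0 < (h - l) * (D * c + E)" by linarith
  then have pos: "0 < D * c + E" using f by (simp add: zero_less_mult_iff)
  have "(h - c) * ((c - l) * h powr r) \<le> (h - c) * ((h - l) * (D * c + E))"
    using f 0 by (intro mult_left_mono) auto
  then have 1: "b\<^sup>2 * h powr r \<le> ((h - c) * (h - l)) * (D * c + E)"
    by (simp only: cl[symmetric] mult.assoc)
  have "(h - c) * (h - l) \<le> h * h" using f by (intro mult_mono) auto
  then have "((h - c) * (h - l)) * (D * c + E) \<le> (h * h) * (D * c + E)" using pos by (intro mult_right_mono) auto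
  then have "b\<^sup>2 * h powr r \<le> (D * c + E) * (h * h)" using 1 by (simp only: mult.commute[of "D * c + E"])
  then have "b\<^sup>2 * h powr r / (h * h) \<le> D * c + E" using f by (subst pos_divide_le_eq) auto
  moreover have "h powr (r - 2) = h powr r / (h * h)" using f by (simp add: powr_diff power2_eq_square)
  ultimately have "h powr (r - 2) * b\<^sup>2 \<le> D * c + E" by (simp add: mult.commute)
  then show ?thesis by (simp add: mpow_sym_mat2[OF pd_imp_psd[OF assms] b] D_def E_def h_def)
qed

text \<open>The form of \<open>Y - X\<close> is evaluated at the \<open>i\<close>-th unit
  vector.\<close>

lemma loewner_le_index:
  assumes "loewner_le n X Y" "i < n"
  shows "Re (X $$ (i,i)) \<le> Re (Y $$ (i,i))"
proof -
  have c: "X \<in> carrier_mat n n" "Y \<in> carrier_mat n n" using assms unfolding loewner_le_def by auto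
  have "qform (Y - X) (unit_vec n i) = (\<Sum>j<n. \<Sum>k<n. if k = i then if j = i then (Y - X) $$ (i,i) else 0 else 0)"
    unfolding qform_def index_unit_vec(3) by (intro sum.cong refl) (auto simp: unit_vec_def)
  also have "\<dots> = Y $$ (i,i) - X $$ (i,i)" using c assms(2) by simp
  finally have "qform (Y - X) (unit_vec n i) = Y $$ (i,i) - X $$ (i,i)" .
  moreover have "0 \<le> Re (qform (Y - X) (unit_vec n i))" using assms unfolding loewner_le_def psd_def by simp
  ultimately show ?thesis by simp
qed

section \<open>Necessity of the conditions on the exponents\<close>

locale powmean_le_2 =
  fixes \<alpha> p q :: real
  assumes \<alpha>: "0 < \<alpha>" "\<alpha> < 1" and p: "0 < p" and q: "0 < q"
    and le: "\<And>A B. pd 2 A \<Longrightarrow> pd 2 B \<Longrightarrow> loewner_le 2 (powmean \<alpha> p A B) (powmean \<alpha> q A B)"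
begin

text \<open>The given matrices play the roles of \<open>A^q\<close> and \<open>B^q\<close>, so
  \<open>A^p\<close> and \<open>B^p\<close> are their powers \<open>p / q\<close>. The balance
  condition makes the mean of \<open>A^q\<close> and \<open>B^q\<close> diagonal and its power
  \<open>1 / q\<close> explicit; the other power mean is bounded below by
  \<open>mpow_sym_mat2_lower_bound\<close>.\<close>

lemma balanced_pair:
  assumes pd1: "pd 2 (sym_mat2 a1 b1 c1)" and pd2: "pd 2 (sym_mat2 a2 b2 c2)" and b: "b1 \<noteq> 0" "b2 \<noteq> 0"
    and bal: "(1 - \<alpha>) * b1 + \<alpha> * b2 = 0"
  defines "D1 \<equiv> powr_slope (p / q) a1 b1 c1" and "E1 \<equiv> powr_icpt (p / q) a1 b1 c1"
    and "D2 \<equiv> powr_slope (p / q) a2 b2 c2" and "E2 \<equiv> powr_icpt (p / q) a2 b2 c2"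
  shows "eig_max ((1 - \<alpha>) * (D1 * a1 + E1) + \<alpha> * (D2 * a2 + E2)) ((1 - \<alpha>) * (D1 * b1) + \<alpha> * (D2 * b2))
      ((1 - \<alpha>) * (D1 * c1 + E1) + \<alpha> * (D2 * c2 + E2)) powr (1 / p - 2)
    * ((1 - \<alpha>) * (D1 * b1) + \<alpha> * (D2 * b2))\<^sup>2 \<le> ((1 - \<alpha>) * c1 + \<alpha> * c2) powr (1 / q)"
    (is "eig_max ?x ?y ?z powr _ * _ \<le> _")
proof -
  let ?A = "mpow (sym_mat2 a1 b1 c1) (1 / q)" and ?B = "mpow (sym_mat2 a2 b2 c2) (1 / q)"
  note psd1 = pd_imp_psd[OF pd1] and psd2 = pd_imp_psd[OF pd2]
  have X: "wmean \<alpha> (mpow ?A p) (mpow ?B p) = sym_mat2 ?x ?y ?z"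
    unfolding mpow_mpow[OF psd1] mpow_mpow[OF psd2]
    by (simp add: mpow_sym_mat2[OF psd1 b(1)] mpow_sym_mat2[OF psd2 b(2)] wmean_sym_mat2 D1_def D2_def E1_def E2_def)
  have "pd 2 (wmean \<alpha> (mpow (sym_mat2 a1 b1 c1) (p / q)) (mpow (sym_mat2 a2 b2 c2) (p / q)))"
    using pd_wmean[OF pd_mpow_sym_mat2[OF pd1 b(1)] pd_mpow_sym_mat2[OF pd2 b(2)] \<alpha>] .
  then have pdX: "pd 2 (sym_mat2 ?x ?y ?z)"
    by (simp add: mpow_sym_mat2[OF psd1 b(1)] mpow_sym_mat2[OF psd2 b(2)] wmean_sym_mat2 D1_def D2_def E1_def E2_def)
  have Y: "wmean \<alpha> (mpow ?A q) (mpow ?B q) = sym_mat2 ((1 - \<alpha>) * a1 + \<alpha> * a2) 0 ((1 - \<alpha>) * c1 + \<alpha> * c2)"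
    unfolding mpow_mpow[OF psd1] mpow_mpow[OF psd2]
    using q by (simp add: mpow_1[OF psd1] mpow_1[OF psd2] wmean_sym_mat2 bal)
  have "a1 > 0" "c1 > 0" "a2 > 0" "c2 > 0"
    using pd1 pd2 eig_bounds(7)[OF pd1 b(1)] eig_bounds(7)[OF pd2 b(2)] by (auto simp: pd_sym_mat2_iff)
  then have nn: "(1 - \<alpha>) * a1 + \<alpha> * a2 \<ge> 0" "(1 - \<alpha>) * c1 + \<alpha> * c2 \<ge> 0" using \<alpha> by auto
  have "eig_max ?x ?y ?z powr (1 / p - 2) * ?y\<^sup>2 \<le> Re (powmean \<alpha> p ?A ?B $$ (1,1))"
    unfolding powmean_eq X by (rule mpow_sym_mat2_lower_bound[OF pdX])
  also have "\<dots> \<le> Re (powmean \<alpha> q ?A ?B $$ (1,1))"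
    by (rule loewner_le_index[OF le[OF pd_mpow_sym_mat2[OF pd1 b(1)] pd_mpow_sym_mat2[OF pd2 b(2)]]]) simp
  also have "\<dots> = ((1 - \<alpha>) * c1 + \<alpha> * c2) powr (1 / q)"
    unfolding powmean_eq Y mpow_sym_mat2_diag[OF nn] by simp
  finally show ?thesis .
qed

end

section \<open>Limits of families that degenerate to a diagonal matrix\<close>

lemma tendsto_eig:
  assumes "(a \<longlongrightarrow> L) F" "(b \<longlongrightarrow> 0) F" "(c \<longlongrightarrow> 0) F" "L > 0"
  shows "((\<lambda>x. eig_max (a x) (b x) (c x)) \<longlongrightarrow> L) F" "((\<lambda>x. eig_min (a x) (b x) (c x)) \<longlongrightarrow> 0) F"
proof -
  have "((\<lambda>x. eig_max (a x) (b x) (c x)) \<longlongrightarrow> (L + 0 + sqrt ((L - 0)\<^sup>2 + 4 * 0\<^sup>2)) / 2) F"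
    "((\<lambda>x. eig_min (a x) (b x) (c x)) \<longlongrightarrow> (L + 0 - sqrt ((L - 0)\<^sup>2 + 4 * 0\<^sup>2)) / 2) F"
    unfolding eig_max_def eig_min_def by (intro tendsto_intros assms; simp)+
  then show "((\<lambda>x. eig_max (a x) (b x) (c x)) \<longlongrightarrow> L) F" "((\<lambda>x. eig_min (a x) (b x) (c x)) \<longlongrightarrow> 0) F"
    using assms(4) by simp_all
qed

text \<open>In the limit the eigenvalues are \<open>L\<close> and 0, and the line through
  \<open>(0, 0)\<close> and \<open>(L, L^r)\<close> has slope \<open>L^(r - 1)\<close> and intercept
  0.\<close>

lemma tendsto_powr_slope_icpt:
  assumes lim: "(a \<longlongrightarrow> L) F" "(b \<longlongrightarrow> 0) F" "(c \<longlongrightarrow> 0) F" "L > 0" and r: "r > 0"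
    and ev: "eventually (\<lambda>x. pd 2 (sym_mat2 (a x) (b x) (c x)) \<and> b x \<noteq> 0) F"
  shows "((\<lambda>x. powr_slope r (a x) (b x) (c x)) \<longlongrightarrow> L powr (r - 1)) F"
    "((\<lambda>x. powr_icpt r (a x) (b x) (c x)) \<longlongrightarrow> 0) F"
proof -
  note hl = tendsto_eig[OF lim]
  \<comment> \<open>Nonnegativity is the side condition for passing to the limit at base 0.\<close>
  have "eventually (\<lambda>x. eig_min (a x) (b x) (c x) \<ge> 0) F"
    using ev by eventually_elim (auto dest: eig_bounds(1))
  then have l: "((\<lambda>x. eig_min (a x) (b x) (c x) powr r) \<longlongrightarrow> 0 powr r) F"
    using r by (intro tendsto_powr' hl tendsto_const) auto
  have h: "((\<lambda>x. eig_max (a x) (b x) (c x) powr r) \<longlongrightarrow> L powr r) F"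
    using lim(4) by (intro tendsto_powr hl tendsto_const) auto
  have "((\<lambda>x. powr_slope r (a x) (b x) (c x)) \<longlongrightarrow> (L powr r - 0 powr r) / (L - 0)) F"
    unfolding powr_slope_def using lim(4) by (intro tendsto_divide tendsto_diff h l hl) auto
  then show s: "((\<lambda>x. powr_slope r (a x) (b x) (c x)) \<longlongrightarrow> L powr (r - 1)) F"
    using lim(4) by (simp add: powr_diff)
  have "((\<lambda>x. powr_icpt r (a x) (b x) (c x)) \<longlongrightarrow> L powr r - L powr (r - 1) * L) F"
    unfolding powr_icpt_def by (intro tendsto_diff tendsto_mult h s hl)
  then show "((\<lambda>x. powr_icpt r (a x) (b x) (c x)) \<longlongrightarrow> 0) F"
    using lim(4) by (simp add: powr_diff)
qed

text \<open>After division by \<open>(g t)^2\<close> the left side tends to the positive number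
  \<open>L powr e * \<kappa>^2\<close> and the right side to 0. Here \<open>g\<close> is the order
  of magnitude of the off-diagonal entry \<open>y\<close>.\<close>

lemma eig_max_powr_limit_contradiction:
  fixes x y z g R :: "real \<Rightarrow> real"
  assumes F: "F \<noteq> bot" and x: "(x \<longlongrightarrow> L) F" "L > 0" and z: "(z \<longlongrightarrow> 0) F"
    and g: "(g \<longlongrightarrow> 0) F" "eventually (\<lambda>t. g t > 0) F"
    and y: "((\<lambda>t. y t / g t) \<longlongrightarrow> \<kappa>) F" "\<kappa> \<noteq> 0"
    and R: "((\<lambda>t. R t / (g t)\<^sup>2) \<longlongrightarrow> 0) F"
    and le: "eventually (\<lambda>t. eig_max (x t) (y t) (z t) powr e * (y t)\<^sup>2 \<le> R t) F"
  shows False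
proof -
  have "((\<lambda>t. y t / g t * g t) \<longlongrightarrow> \<kappa> * 0) F" by (intro tendsto_mult y g)
  then have "(y \<longlongrightarrow> \<kappa> * 0) F"
    by (rule Lim_transform_eventually) (use g(2) in \<open>eventually_elim, simp\<close>)
  then have y0: "(y \<longlongrightarrow> 0) F" by simp
  have lim: "((\<lambda>t. eig_max (x t) (y t) (z t) powr e * (y t / g t)\<^sup>2) \<longlongrightarrow> L powr e * \<kappa>\<^sup>2) F"
    using x(2) by (intro tendsto_mult tendsto_power y tendsto_powr tendsto_const tendsto_eig x z y0) auto
  have "eventually (\<lambda>t. eig_max (x t) (y t) (z t) powr e * (y t / g t)\<^sup>2 \<le> R t / (g t)\<^sup>2) F"
    using le g(2) by eventually_elim (simp add: power_divide divide_right_mono)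
  from tendsto_le[OF F R lim this] have "L powr e * \<kappa>\<^sup>2 \<le> 0" .
  moreover have "L powr e * \<kappa>\<^sup>2 > 0" using x(2) y(2) by simp
  ultimately show False by simp
qed

section \<open>The restrictions on the exponents\<close>

context powmean_le_2 begin

text \<open>Multiples of the identity reduce the claim to scalars. For \<open>\<eta>\<close> and 1,
  with \<open>\<eta>\<close> tending to 0, the means tend to \<open>\<alpha> powr (1 / p)\<close>
  and \<open>\<alpha> powr (1 / q)\<close>, and \<open>\<alpha> < 1\<close> decides their
  order.\<close>

lemma exponent_le: "p \<le> q"
proof (rule ccontr)
  assume "\<not> p \<le> q"
  have ev: "eventually (\<lambda>\<eta>. ((1 - \<alpha>) * \<eta> powr p + \<alpha>) powr (1 / p) \<le> ((1 - \<alpha>) * \<eta> powr q + \<alpha>) powr (1 / q)) (at_right 0)"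
    using eventually_at_right_less[of 0]
  proof eventually_elim
    fix \<eta> :: real assume \<eta>: "0 < \<eta>"
    have *: "powmean \<alpha> r (sym_mat2 \<eta> 0 \<eta>) (sym_mat2 1 0 1) = sym_mat2 (((1 - \<alpha>) * \<eta> powr r + \<alpha>) powr (1 / r)) 0 (((1 - \<alpha>) * \<eta> powr r + \<alpha>) powr (1 / r))" for r
      using \<eta> \<alpha> by (simp add: powmean_eq mpow_sym_mat2_diag wmean_sym_mat2)
    have "loewner_le 2 (powmean \<alpha> p (sym_mat2 \<eta> 0 \<eta>) (sym_mat2 1 0 1)) (powmean \<alpha> q (sym_mat2 \<eta> 0 \<eta>) (sym_mat2 1 0 1))"
      using \<eta> by (intro le) (auto simp: pd_sym_mat2_iff)
    from loewner_le_index[OF this, of 1]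
    show "((1 - \<alpha>) * \<eta> powr p + \<alpha>) powr (1 / p) \<le> ((1 - \<alpha>) * \<eta> powr q + \<alpha>) powr (1 / q)"
      unfolding * by simp
  qed
  have lim: "((\<lambda>\<eta>. ((1 - \<alpha>) * \<eta> powr r + \<alpha>) powr (1 / r)) \<longlongrightarrow> \<alpha> powr (1 / r)) (at_right 0)" if "r > 0" for r
  proof -
    have "((\<lambda>\<eta>::real. \<eta> powr r) \<longlongrightarrow> 0) (at_right 0)" using that by real_asymp
    then have "((\<lambda>\<eta>. ((1 - \<alpha>) * \<eta> powr r + \<alpha>) powr (1 / r)) \<longlongrightarrow> ((1 - \<alpha>) * 0 + \<alpha>) powr (1 / r)) (at_right 0)"
      by (intro tendsto_powr tendsto_add tendsto_mult tendsto_const) (use \<alpha> in auto)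
    then show ?thesis by simp
  qed
  have "\<alpha> powr (1 / p) \<le> \<alpha> powr (1 / q)"
    by (rule tendsto_le[OF _ lim[OF q] lim[OF p] ev]) simp
  moreover have "\<alpha> powr (1 / q) < \<alpha> powr (1 / p)"
    using \<alpha> p q \<open>\<not> p \<le> q\<close> by (intro powr_less_mono') (auto simp: field_simps)
  ultimately show False by simp
qed

text \<open>With off-diagonal entries of order \<open>x\<close> and lower diagonal entries
  \<open>x^2\<close>, the off-diagonal entry of the mean of the \<open>p\<close>-th powers stays of
  order \<open>x\<close>. The bound then compares \<open>x^2\<close> with \<open>x^(2/q)\<close> and
  fails for small \<open>x\<close> when \<open>q < 1\<close>.\<close>

lemma exponent_ge_1:
  assumes "p < q" shows "q \<ge> 1"
proof (rule ccontr)
  assume "\<not> q \<ge> 1"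
  define r where "r = p / q"
  have r: "0 < r" "r < 1" using p q assms unfolding r_def by auto
  define F where "F = at_right (0::real)"
  have F: "((\<lambda>x. x) \<longlongrightarrow> 0) F" "eventually (\<lambda>x. x > 0) F" unfolding F_def
    by (auto intro!: tendsto_intros simp: eventually_at_right_less)
  \<comment> \<open>The factors \<open>\<alpha>\<close> and \<open>- (1 - \<alpha>)\<close> balance
    the off-diagonal entries. The upper entries 1 and 2 differ so that the limiting slopes 1 and
    \<open>2 powr (r - 1)\<close> differ, and the balance is lost in the powers.\<close>
  define D1 where "D1 x = powr_slope r 1 (\<alpha> * x) (x\<^sup>2)" for x
  define E1 where "E1 x = powr_icpt r 1 (\<alpha> * x) (x\<^sup>2)" for x
  define D2 where "D2 x = powr_slope r 2 (- (1 - \<alpha>) * x) (x\<^sup>2)" for x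
  define E2 where "E2 x = powr_icpt r 2 (- (1 - \<alpha>) * x) (x\<^sup>2)" for x
  have sq: "\<alpha>\<^sup>2 < 1" "(1 - \<alpha>)\<^sup>2 < 1" using \<alpha> by (auto simp: power_less_one_iff abs_square_less_1)
  have pd1: "pd 2 (sym_mat2 1 (\<alpha> * x) (x\<^sup>2))" if "x > 0" for x
    using that sq by (simp add: pd_sym_mat2_iff power_mult_distrib)
  have pd2: "pd 2 (sym_mat2 2 (- (1 - \<alpha>) * x) (x\<^sup>2))" if "x > 0" for x
  proof -
    have "(1 - \<alpha>)\<^sup>2 * x\<^sup>2 < 2 * x\<^sup>2" using that sq by (intro mult_strict_right_mono) auto
    then show ?thesis by (simp add: pd_sym_mat2_iff power_mult_distrib power2_commute)
  qed
  have "((\<lambda>x. \<alpha> * x) \<longlongrightarrow> \<alpha> * 0) F" "((\<lambda>x. - (1 - \<alpha>) * x) \<longlongrightarrow> - (1 - \<alpha>) * 0) F" "((\<lambda>x. x\<^sup>2) \<longlongrightarrow> 0\<^sup>2) F"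
    by (intro tendsto_intros F)+
  then have l0: "((\<lambda>x. \<alpha> * x) \<longlongrightarrow> 0) F" "((\<lambda>x. - (1 - \<alpha>) * x) \<longlongrightarrow> 0) F" "((\<lambda>x. x\<^sup>2) \<longlongrightarrow> 0) F" by simp_all
  have ev: "eventually (\<lambda>x. pd 2 (sym_mat2 1 (\<alpha> * x) (x\<^sup>2)) \<and> \<alpha> * x \<noteq> 0) F"
    "eventually (\<lambda>x. pd 2 (sym_mat2 2 (- (1 - \<alpha>) * x) (x\<^sup>2)) \<and> - (1 - \<alpha>) * x \<noteq> 0) F"
    using F(2) by (eventually_elim, use \<alpha> pd1 pd2 in auto)+
  have 1: "(D1 \<longlongrightarrow> 1 powr (r - 1)) F" "(E1 \<longlongrightarrow> 0) F"
    unfolding D1_def[abs_def] E1_def[abs_def]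
    by (intro tendsto_powr_slope_icpt[where a="\<lambda>_. 1" and b="\<lambda>x. \<alpha> * x" and c="\<lambda>x. x\<^sup>2" and L="1"] tendsto_const l0 F(1) r(1) ev less_numeral_extra(1))+
  have 2: "(D2 \<longlongrightarrow> 2 powr (r - 1)) F" "(E2 \<longlongrightarrow> 0) F"
    unfolding D2_def[abs_def] E2_def[abs_def]
    by (intro tendsto_powr_slope_icpt[where a="\<lambda>_. 2" and b="\<lambda>x. - (1 - \<alpha>) * x" and c="\<lambda>x. x\<^sup>2" and L="2"] tendsto_const l0 F(1) r(1) ev zero_less_numeral)+
  define x where "x t = (1 - \<alpha>) * (D1 t * 1 + E1 t) + \<alpha> * (D2 t * 2 + E2 t)" for t
  define y where "y t = (1 - \<alpha>) * (D1 t * (\<alpha> * t)) + \<alpha> * (D2 t * (- (1 - \<alpha>) * t))" for t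
  define z where "z t = (1 - \<alpha>) * (D1 t * t\<^sup>2 + E1 t) + \<alpha> * (D2 t * t\<^sup>2 + E2 t)" for t
  show False
  proof (rule eig_max_powr_limit_contradiction[of F x _ z "\<lambda>t. t" y])
    show "F \<noteq> bot" unfolding F_def by simp
    show "(x \<longlongrightarrow> (1 - \<alpha>) * (1 powr (r - 1) * 1 + 0) + \<alpha> * (2 powr (r - 1) * 2 + 0)) F"
      unfolding x_def[abs_def] by (intro tendsto_intros 1 2)
    show "(1 - \<alpha>) * (1 powr (r - 1) * 1 + 0) + \<alpha> * (2 powr (r - 1) * 2 + 0) > 0" using \<alpha> by (simp add: add_pos_pos)
    have "(z \<longlongrightarrow> (1 - \<alpha>) * (1 powr (r - 1) * 0 + 0) + \<alpha> * (2 powr (r - 1) * 0 + 0)) F"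
      unfolding z_def[abs_def] by (intro tendsto_add tendsto_mult tendsto_const l0 1 2)
    then show "(z \<longlongrightarrow> 0) F" by simp
    have "((\<lambda>t. (1 - \<alpha>) * \<alpha> * (D1 t - D2 t)) \<longlongrightarrow> (1 - \<alpha>) * \<alpha> * (1 powr (r - 1) - 2 powr (r - 1))) F"
      by (intro tendsto_mult tendsto_diff tendsto_const 1 2)
    then show "((\<lambda>t. y t / t) \<longlongrightarrow> (1 - \<alpha>) * \<alpha> * (1 powr (r - 1) - 2 powr (r - 1))) F"
      by (rule Lim_transform_eventually) (use F(2) in \<open>eventually_elim, simp add: y_def field_simps\<close>)
    \<comment> \<open>Since \<open>r < 1\<close>, that is \<open>p < q\<close>, the limit of
      \<open>y t / t\<close> is nonzero.\<close>
    have "2 powr (r - 1) < (2::real) powr 0" using r by (intro powr_less_mono) auto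
    then show "(1 - \<alpha>) * \<alpha> * (1 powr (r - 1) - 2 powr (r - 1)) \<noteq> 0" using \<alpha> r by simp
    have "1 / q > 1" using \<open>\<not> q \<ge> 1\<close> q by simp
    then show "((\<lambda>t. (t\<^sup>2) powr (1 / q) / t\<^sup>2) \<longlongrightarrow> 0) F" unfolding F_def by real_asymp
    show "eventually (\<lambda>t. eig_max (x t) (y t) (z t) powr (1 / p - 2) * (y t)\<^sup>2 \<le> (t\<^sup>2) powr (1 / q)) F"
      using F(2)
    proof eventually_elim
      fix t :: real assume t: "t > 0"
      have "(1 - \<alpha>) * (\<alpha> * t) + \<alpha> * (- (1 - \<alpha>) * t) = 0" by (simp add: algebra_simps)
      from balanced_pair[OF pd1[OF t] pd2[OF t] _ _ this]
      have "eig_max (x t) (y t) (z t) powr (1 / p - 2) * (y t)\<^sup>2 \<le> ((1 - \<alpha>) * t\<^sup>2 + \<alpha> * t\<^sup>2) powr (1 / q)"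
        using t \<alpha> unfolding x_def y_def z_def D1_def D2_def E1_def E2_def r_def by simp
      also have "(1 - \<alpha>) * t\<^sup>2 + \<alpha> * t\<^sup>2 = t\<^sup>2" by (simp add: algebra_simps)
      finally show "eig_max (x t) (y t) (z t) powr (1 / p - 2) * (y t)\<^sup>2 \<le> (t\<^sup>2) powr (1 / q)" .
    qed
  qed (use F in auto)
qed

text \<open>The second matrix is \<open>x\<close> times a fixed one, so its power
  \<open>r = p / q\<close> has entries of order \<open>x^r\<close>, which dominate the off-diagonal
  entry of order \<open>x\<close> coming from the first. The bound then compares
  \<open>x^(2 r)\<close> with \<open>x^(1/q)\<close> and fails for small \<open>x\<close> when
  \<open>p < 1/2\<close>.\<close>

lemma exponent_ge_half:
  assumes "p < q" shows "p \<ge> 1 / 2"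
proof (rule ccontr)
  assume "\<not> p \<ge> 1 / 2"
  define r where "r = p / q"
  have r: "0 < r" "r < 1" using p q assms unfolding r_def by auto
  define F where "F = at_right (0::real)"
  have F: "((\<lambda>x. x) \<longlongrightarrow> 0) F" "eventually (\<lambda>x. x > 0) F" "eventually (\<lambda>x. x < 1) F" unfolding F_def
    using eventually_at_right_real[of 0 1]
    by (auto intro!: tendsto_intros simp: eventually_at_right_less elim: eventually_mono)
  define D1 where "D1 x = powr_slope r 1 (\<alpha> * x) x" for x
  define E1 where "E1 x = powr_icpt r 1 (\<alpha> * x) x" for x
  define D2 where "D2 x = powr_slope r x (- (1 - \<alpha>) * x) x" for x
  define E2 where "E2 x = powr_icpt r x (- (1 - \<alpha>) * x) x" for x
  \<comment> \<open>\<open>d\<close> and \<open>e\<close> are the slope and the intercept for the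
    fixed matrix, \<open>x = 1\<close>, whose eigenvalues are \<open>2 - \<alpha>\<close> and
    \<open>\<alpha>\<close>.\<close>
  define d where "d = ((2 - \<alpha>) powr r - \<alpha> powr r) / (2 * (1 - \<alpha>))"
  define e where "e = (2 - \<alpha>) powr r - d * (2 - \<alpha>)"
  have d: "d > 0" unfolding d_def using \<alpha> r by (intro divide_pos_pos) (auto intro!: powr_less_mono2)
  have hl: "eig_max x (- (1 - \<alpha>) * x) x = (2 - \<alpha>) * x" "eig_min x (- (1 - \<alpha>) * x) x = \<alpha> * x" if "x > 0" for x
  proof -
    have "(x - x)\<^sup>2 + 4 * (- (1 - \<alpha>) * x)\<^sup>2 = (2 * (1 - \<alpha>) * x)\<^sup>2" by (simp add: power2_eq_square algebra_simps)
    then have "sqrt ((x - x)\<^sup>2 + 4 * (- (1 - \<alpha>) * x)\<^sup>2) = 2 * (1 - \<alpha>) * x"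
      using \<alpha> that by (simp only: real_sqrt_abs) simp
    then show "eig_max x (- (1 - \<alpha>) * x) x = (2 - \<alpha>) * x" "eig_min x (- (1 - \<alpha>) * x) x = \<alpha> * x"
      unfolding eig_max_def eig_min_def by (auto simp: field_simps)
  qed
  \<comment> \<open>\<open>D2 x\<close> alone is of order \<open>x^(r - 1)\<close> and has no finite
    limit; its product with \<open>x\<close> tends to 0.\<close>
  have D2: "D2 x * x = d * x powr r" if "x > 0" for x
  proof -
    have "((2 - \<alpha>) * x) powr r = (2 - \<alpha>) powr r * x powr r" "(\<alpha> * x) powr r = \<alpha> powr r * x powr r"
      using that \<alpha> by (auto intro!: powr_mult)
    moreover have "(2 - \<alpha>) * x - \<alpha> * x = 2 * (1 - \<alpha>) * x" by (simp add: algebra_simps)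
    ultimately have "D2 x = ((2 - \<alpha>) powr r * x powr r - \<alpha> powr r * x powr r) / (2 * (1 - \<alpha>) * x)"
      unfolding D2_def powr_slope_def hl[OF that] by (simp only:)
    moreover have "(P - Q) / (2 * (1 - \<alpha>) * x) * x = (P - Q) / (2 * (1 - \<alpha>))" for P Q
      using that by simp
    ultimately have "D2 x * x = ((2 - \<alpha>) powr r * x powr r - \<alpha> powr r * x powr r) / (2 * (1 - \<alpha>))"
      by (simp only:)
    then show ?thesis unfolding d_def by (simp only: left_diff_distrib times_divide_eq_left)
  qed
  have E2: "E2 x = e * x powr r" if "x > 0" for x
  proof -
    have "E2 x = ((2 - \<alpha>) * x) powr r - (D2 x * x) * (2 - \<alpha>)"
      unfolding E2_def powr_icpt_def D2_def[symmetric] hl[OF that] by simp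
    also have "((2 - \<alpha>) * x) powr r = (2 - \<alpha>) powr r * x powr r" by (rule powr_mult)
    finally show ?thesis unfolding D2[OF that] e_def by (simp add: algebra_simps)
  qed
  have pd1: "pd 2 (sym_mat2 1 (\<alpha> * x) x)" if "x > 0" "x < 1" for x
  proof -
    have "\<alpha>\<^sup>2 * x < 1 * 1" using that \<alpha> by (intro mult_strict_mono) (auto simp: power_less_one_iff abs_square_less_1)
    then have "\<alpha>\<^sup>2 * x * x < 1 * x" using that by (intro mult_strict_right_mono) auto
    then show ?thesis by (simp add: pd_sym_mat2_iff power_mult_distrib power2_eq_square mult_ac)
  qed
  have pd2: "pd 2 (sym_mat2 x (- (1 - \<alpha>) * x) x)" if "x > 0" for x
  proof -
    have "(1 - \<alpha>)\<^sup>2 * x\<^sup>2 < 1 * x\<^sup>2" using that \<alpha> by (intro mult_strict_right_mono) (auto simp: abs_square_less_1)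
    moreover have "(- (1 - \<alpha>) * x)\<^sup>2 = (1 - \<alpha>)\<^sup>2 * x\<^sup>2" by (simp only: power_mult_distrib power2_minus)
    ultimately show ?thesis using that unfolding pd_sym_mat2_iff by (simp add: power2_eq_square)
  qed
  have "((\<lambda>x. \<alpha> * x) \<longlongrightarrow> \<alpha> * 0) F"
    by (intro tendsto_intros F)+
  then have l0: "((\<lambda>x. \<alpha> * x) \<longlongrightarrow> 0) F" by simp
  have F2: "eventually (\<lambda>x. 0 < x \<and> x < 1) F" using F(2,3) by eventually_elim simp
  have ev: "eventually (\<lambda>x. pd 2 (sym_mat2 1 (\<alpha> * x) x) \<and> \<alpha> * x \<noteq> 0) F"
    using F2 by eventually_elim (use \<alpha> pd1 in auto)
  have 1: "(D1 \<longlongrightarrow> 1 powr (r - 1)) F" "(E1 \<longlongrightarrow> 0) F"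
    unfolding D1_def[abs_def] E1_def[abs_def]
    by (intro tendsto_powr_slope_icpt[where a="\<lambda>_. 1" and b="\<lambda>x. \<alpha> * x" and c="\<lambda>x. x" and L="1"] tendsto_const l0 F(1) r(1) ev less_numeral_extra(1))+
  have g: "((\<lambda>t. t powr r) \<longlongrightarrow> 0) F" unfolding F_def using r by real_asymp
  define x where "x t = (1 - \<alpha>) * (D1 t * 1 + E1 t) + \<alpha> * (D2 t * t + E2 t)" for t
  define y where "y t = (1 - \<alpha>) * (D1 t * (\<alpha> * t)) + \<alpha> * (D2 t * (- (1 - \<alpha>) * t))" for t
  define z where "z t = (1 - \<alpha>) * (D1 t * t + E1 t) + \<alpha> * (D2 t * t + E2 t)" for t
  \<comment> \<open>The second matrix thus contributes nothing to the limits of \<open>x\<close> and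
    \<open>z\<close>, and the largest eigenvalue tends to \<open>1 - \<alpha>\<close>.\<close>
  have 2: "((\<lambda>t. D2 t * t + E2 t) \<longlongrightarrow> 0) F"
  proof -
    have "((\<lambda>t. d * t powr r + e * t powr r) \<longlongrightarrow> d * 0 + e * 0) F" by (intro tendsto_intros g)
    then have "((\<lambda>t. d * t powr r + e * t powr r) \<longlongrightarrow> 0) F" by simp
    then show ?thesis
      by (rule Lim_transform_eventually) (use F(2) in \<open>eventually_elim, simp add: D2 E2\<close>)
  qed
  show False
  proof (rule eig_max_powr_limit_contradiction[of F x _ z "\<lambda>t. t powr r" y])
    show "F \<noteq> bot" unfolding F_def by simp
    show "(x \<longlongrightarrow> (1 - \<alpha>) * (1 powr (r - 1) * 1 + 0) + \<alpha> * 0) F"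
      unfolding x_def[abs_def] by (intro tendsto_add tendsto_mult tendsto_const 1 2)
    show "(1 - \<alpha>) * (1 powr (r - 1) * 1 + 0) + \<alpha> * 0 > 0" using \<alpha> by simp
    have "(z \<longlongrightarrow> (1 - \<alpha>) * (1 powr (r - 1) * 0 + 0) + \<alpha> * 0) F"
      unfolding z_def[abs_def] by (intro tendsto_add tendsto_mult tendsto_const F 1 2)
    then show "(z \<longlongrightarrow> 0) F" by simp
    \<comment> \<open>Divided by \<open>t powr r\<close>, the off-diagonal contribution of the first
      matrix is of order \<open>t powr (1 - r)\<close> and vanishes.\<close>
    have "((\<lambda>t::real. t powr (1 - r)) \<longlongrightarrow> 0) F" unfolding F_def using r by real_asymp
    then have "((\<lambda>t. (1 - \<alpha>) * \<alpha> * (D1 t * t powr (1 - r) - d)) \<longlongrightarrow> (1 - \<alpha>) * \<alpha> * (1 powr (r - 1) * 0 - d)) F"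
      by (intro tendsto_mult tendsto_diff tendsto_const 1)
    then show "((\<lambda>t. y t / t powr r) \<longlongrightarrow> (1 - \<alpha>) * \<alpha> * (1 powr (r - 1) * 0 - d)) F"
    proof (rule Lim_transform_eventually)
      show "eventually (\<lambda>t. (1 - \<alpha>) * \<alpha> * (D1 t * t powr (1 - r) - d) = y t / t powr r) F"
        using F(2)
      proof eventually_elim
        fix t :: real assume t: "t > 0"
        have "y t = (1 - \<alpha>) * \<alpha> * (D1 t * t - D2 t * t)" unfolding y_def by (simp add: algebra_simps)
        also have "\<dots> = (1 - \<alpha>) * \<alpha> * (D1 t * t - d * t powr r)" unfolding D2[OF t] ..
        finally show "(1 - \<alpha>) * \<alpha> * (D1 t * t powr (1 - r) - d) = y t / t powr r"
          using t by (simp add: powr_diff field_simps)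
      qed
    qed
    show "(1 - \<alpha>) * \<alpha> * (1 powr (r - 1) * 0 - d) \<noteq> 0" using \<alpha> d by simp
    \<comment> \<open>This is \<open>p < 1/2\<close> after division by \<open>q\<close>.\<close>
    have "1 / q > 2 * r" using \<open>\<not> p \<ge> 1 / 2\<close> q p unfolding r_def by (simp add: divide_strict_right_mono)
    then show "((\<lambda>t. t powr (1 / q) / (t powr r)\<^sup>2) \<longlongrightarrow> 0) F" unfolding F_def by real_asymp
    show "eventually (\<lambda>t. eig_max (x t) (y t) (z t) powr (1 / p - 2) * (y t)\<^sup>2 \<le> t powr (1 / q)) F"
      using F2
    proof (eventually_elim, elim conjE)
      fix t :: real assume t: "t > 0" "t < 1"
      have "(1 - \<alpha>) * (\<alpha> * t) + \<alpha> * (- (1 - \<alpha>) * t) = 0" by (simp add: algebra_simps)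
      from balanced_pair[OF pd1[OF t] pd2[OF t(1)] _ _ this]
      have "eig_max (x t) (y t) (z t) powr (1 / p - 2) * (y t)\<^sup>2 \<le> ((1 - \<alpha>) * t + \<alpha> * t) powr (1 / q)"
        using t \<alpha> unfolding x_def y_def z_def D1_def D2_def E1_def E2_def r_def by simp
      also have "(1 - \<alpha>) * t + \<alpha> * t = t" by (simp add: algebra_simps)
      finally show "eig_max (x t) (y t) (z t) powr (1 / p - 2) * (y t)\<^sup>2 \<le> t powr (1 / q)" .
    qed
    show "eventually (\<lambda>t. t powr r > 0) F" using F(2) by eventually_elim simp
  qed (use g in auto)
qed

lemma exponent_range: "p = q \<or> (1 \<le> p \<and> p < q) \<or> (1 / 2 \<le> p \<and> p < 1 \<and> 1 \<le> q)"
  using exponent_le exponent_ge_1 exponent_ge_half by linarith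

end

theorem theorem4p1:
  fixes \<alpha> p q :: real
  assumes "0 < \<alpha>" "\<alpha> < 1" "0 < p" "0 < q"
  shows "((\<forall>n A B. psd n A \<and> psd n B \<longrightarrow> loewner_le n (powmean \<alpha> p A B) (powmean \<alpha> q A B))
           \<longleftrightarrow> (\<forall>A B. pd 2 A \<and> pd 2 B \<longrightarrow> loewner_le 2 (powmean \<alpha> p A B) (powmean \<alpha> q A B)))
       \<and> ((\<forall>A B. pd 2 A \<and> pd 2 B \<longrightarrow> loewner_le 2 (powmean \<alpha> p A B) (powmean \<alpha> q A B))
           \<longleftrightarrow> (p = q \<or> (1 \<le> p \<and> p < q) \<or> (1/2 \<le> p \<and> p < 1 \<and> 1 \<le> q)))"
    (is "(?i \<longleftrightarrow> ?ii) \<and> (_ \<longleftrightarrow> ?iii)")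
proof -
  have "?i \<longrightarrow> ?ii" using pd_imp_psd by blast
  moreover have "?ii \<longrightarrow> ?iii"
  proof
    assume ?ii
    then interpret powmean_le_2 \<alpha> p q using assms by unfold_locales auto
    show ?iii by (rule exponent_range)
  qed
  moreover have "?iii \<longrightarrow> ?i" using powmean_mono[of _ _ _ \<alpha> p q] assms by auto
  ultimately show ?thesis by blast
qed

end
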